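(* Let $X$ be an infinite-dimensional real Banach space. Then there is a Banach space $C(K)$ for some compact Hausdorff space $K$ (namely the one fixed in the context together with the map $\mathbb T:\mathcal B(X)\to C(K)^+$) such that for every convex measure of noncompactness $\mu$ on $X$ there is a function $F$ on the cone $V=\mathbb T(\mathcal B(X))\subset C(K)^+$ satisfying: (i) $\mu(B)=F(\mathbb T B)$ for all $B\in\mathcal B(X)$; (ii) $F$ is nonnegative-valued, convex and monotone (i.e. $f\le g$ in $V$ implies $F(f)\le F(g)$) on $V$; (iii) for all $r\ge 0$, $F$ is bounded by $b_r=F(r\,\mathbb T B_X)$ on $V\cap (rB_{C(K)})$; (iv) for all $r\ge 0$, $F$ is $c_r$-Lipschitzian on $V\cap(rB_{C(K)})$, where $c_r=F\big((1+r)\mathbb T B_X\big)=\mu\big((1+r)B_X\big)$; (v) in particular, if $\mu$ is a sublinear measure of noncompactness, then one can take $c_r=\mu(B_X)$ in (iv).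
   Context: $X$ is an infinite-dimensional real Banach space with closed unit ball $B_X$; $B_{C(K)}$ is the closed unit ball of $C(K)$. $\mathcal B(X)$ is the set of nonempty bounded subsets of $X$, $\mathcal C(X)$ the set of nonempty closed bounded convex subsets, $\mathcal K(X)$ the set of nonempty compact convex subsets. $\Omega=B_{X^*}$ carries the norm topology and $C_b(\Omega)$ is the space of bounded continuous real functions on $\Omega$ with the sup-norm and pointwise order. For $B\in\mathcal B(X)$ let $J(B)\in C_b(\Omega)$, $J(B)(x^* )=\sup_{b\in B}\langle x^*,b\rangle$ (so $J(B)=J(\overline{\rm co}(B))$). Put $E_{\mathcal C}=\overline{J\mathcal C(X)-J\mathcal C(X)}$ and $E_{\mathcal K}=\overline{J\mathcal K(X)-J\mathcal K(X)}$ (closures in $C_b(\Omega)$). It is known that $E_{\mathcal C}$ is a Banach lattice, $E_{\mathcal K}$ is a lattice ideal of it, and $E_{\mathcal C}/E_{\mathcal K}$ is an abstract $M$ space, so there are a compact Hausdorff space $K$ and a linear order isometry $T$ from $E_{\mathcal C}/E_{\mathcal K}$ onto a sublattice of $C(K)$; fix such $K$ and $T$. Let $Q:E_{\mathcal C}\to E_{\mathcal C}/E_{\mathcal K}$ be the quotient map and $\mathbb T=TQJ:\mathcal B(X)\to C(K)^+$ (its values lie in the positive cone $C(K)^+$). $V=\mathbb T(\mathcal B(X))=\mathbb T(\mathcal C(X))$, a closed cone. A convex measure of noncompactness (convex MNC) on $X$ is a function $\mu:\mathcal B(X)\to[0,\infty)$ such that for all $A,B\in\mathcal B(X)$: (1)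 $\mu(B)=0$ iff $B$ is relatively compact; (2) $A\supset B$ implies $\mu(A)\ge\mu(B)$; (3) $\mu({\rm co}(B))=\mu(B)$; (4) $\mu(\lambda A+(1-\lambda)B)\le\lambda\mu(A)+(1-\lambda)\mu(B)$ for $0\le\lambda\le1$. A sublinear MNC is a function satisfying (1), (2), (3) together with $\mu(A+B)\le\mu(A)+\mu(B)$ and $\mu(kB)=k\mu(B)$ for all $k\ge0$.
   Formalization: E_K is not a lattice ideal of E_C for infinite-dimensional X, so no order isometry T of E_C/E_K exists; existence of K and T is proved with E_K replaced by the closed lattice ideal of E_C it generates, and (i)–(v) hold for every such K and T. *)

theory Defs
  imports "HOL-Analysis.Analysis"
begin

section \<open>Bounded continuous functions on the dual unit ball\<close>

typedef (overloaded) 'a dual_ball = "cball 0 1 :: ('a::real_normed_vector \<Rightarrow>\<^sub>L real) set"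
  morphisms functional Dual_ball
  by (rule exI[of _ 0]) simp

text \<open>The dual unit ball carries the norm topology, i.e. the metric inherited from the dual space.\<close>

instantiation dual_ball :: (real_normed_vector) metric_space
begin

definition dist_dual_ball :: "'a dual_ball \<Rightarrow> 'a dual_ball \<Rightarrow> real"
  where "dist_dual_ball p q = dist (functional p) (functional q)"

definition uniformity_dual_ball :: "('a dual_ball \<times> 'a dual_ball) filter"
  where "uniformity_dual_ball = (INF e\<in>{0 <..}. principal {(p, q). dist p q < e})"

definition open_dual_ball :: "'a dual_ball set \<Rightarrow> bool"
  where "open_dual_ball S = (\<forall>p\<in>S. \<forall>\<^sub>F (p', q) in uniformity. p' = p \<longrightarrow> q \<in> S)"

instance
proof
  fix p q r :: "'a dual_ball"
  show "dist p q = 0 \<longleftrightarrow> p = q"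
    by (simp add: dist_dual_ball_def functional_inject)
  show "dist p q \<le> dist p r + dist q r"
    unfolding dist_dual_ball_def by (rule dist_triangle2)
qed (rule open_dual_ball_def uniformity_dual_ball_def)+

end

type_synonym 'a cb_dual = "'a dual_ball \<Rightarrow>\<^sub>C real"

definition bounded_sets :: "'a::real_normed_vector set set"
  where "bounded_sets = {B. B \<noteq> {} \<and> bounded B}"

definition closed_bounded_convex_sets :: "'a::real_normed_vector set set"
  where "closed_bounded_convex_sets = {B. B \<noteq> {} \<and> closed B \<and> bounded B \<and> convex B}"

definition compact_convex_sets :: "'a::real_normed_vector set set"
  where "compact_convex_sets = {B. B \<noteq> {} \<and> compact B \<and> convex B}"

text \<open>For bounded nonempty \<open>B\<close> the support function is Lipschitz and bounded on the ball, so that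
  \<open>Bcontfun\<close> is applied inside its domain.\<close>

definition J :: "'a::real_normed_vector set \<Rightarrow> 'a cb_dual"
  where "J B = Bcontfun (\<lambda>\<omega>. SUP b\<in>B. blinfun_apply (functional \<omega>) b)"

definition E_C :: "'a::real_normed_vector cb_dual set"
  where "E_C = closure {J A - J B | A B. A \<in> closed_bounded_convex_sets
                                       \<and> B \<in> closed_bounded_convex_sets}"

definition E_K :: "'a::real_normed_vector cb_dual set"
  where "E_K = closure {J A - J B | A B. A \<in> compact_convex_sets \<and> B \<in> compact_convex_sets}"

definition closed_lattice_ideal :: "'a::real_normed_vector cb_dual set \<Rightarrow> bool"
  where "closed_lattice_ideal I \<longleftrightarrow>
    I \<subseteq> E_C \<and> closed I \<and> subspace I \<and>
    (\<forall>f\<in>E_C. \<forall>g\<in>I. (\<forall>\<omega>. \<bar>apply_bcontfun f \<omega>\<bar> \<le> \<bar>apply_bcontfun g \<omega>\<bar>) \<longrightarrow> f \<in> I)"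

text \<open>The closed lattice ideal of \<open>E_C\<close> generated by \<open>E_K\<close>. It equals \<open>E_K\<close> as soon as \<open>E_K\<close> is a
  lattice ideal, which is commonly asserted. That assertion fails, however, when the space is
  infinite-dimensional: for a unit vector \<open>x\<close>, the function sending \<open>\<omega>\<close> to
  \<open>min \<bar>\<omega>(x)\<bar> (norm \<omega> / 4)\<close> lies in \<open>E_C\<close> between \<open>0\<close> and the element
  \<open>\<bar>\<omega>(x)\<bar>\<close> of \<open>E_K\<close>, but is not weak-star continuous on the ball,
  whereas all elements of \<open>E_K\<close> are. Consequently the quotient of \<open>E_C\<close> by \<open>E_K\<close> itself admits no
  linear order isometry into a space of continuous functions; the quotient by this ideal does.\<close>

definition E_K_ideal :: "'a::real_normed_vector cb_dual set"
  where "E_K_ideal = \<Inter>{I. closed_lattice_ideal I \<and> E_K \<subseteq> I}"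


section \<open>The quotient of \<open>E_C\<close>, with elements represented as cosets\<close>

definition Q :: "'a::real_normed_vector cb_dual set \<Rightarrow> 'a cb_dual \<Rightarrow> 'a cb_dual set"
  where "Q N f = (\<lambda>g. f + g) ` N"

definition coset_norm :: "'a::real_normed_vector cb_dual set \<Rightarrow> real"
  where "coset_norm c = Inf (norm ` c)"

definition coset_le :: "'a::real_normed_vector cb_dual set \<Rightarrow> 'a cb_dual set \<Rightarrow> bool"
  where "coset_le c d \<longleftrightarrow> (\<exists>f\<in>c. \<exists>g\<in>d. \<forall>\<omega>. apply_bcontfun f \<omega> \<le> apply_bcontfun g \<omega>)"


section \<open>The space \<open>C(K)\<close>\<close>

text \<open>The values off the carrier of \<open>K\<close> are fixed to be \<open>0\<close>, so that equality of elements is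
  equality on \<open>K\<close>.\<close>

definition C_space :: "'k topology \<Rightarrow> ('k \<Rightarrow> real) set"
  where "C_space K = {f. continuous_map K euclideanreal f \<and> (\<forall>k. k \<notin> topspace K \<longrightarrow> f k = 0)}"

text \<open>The inserted \<open>0\<close> only matters for empty \<open>K\<close>.\<close>

definition C_norm :: "'k topology \<Rightarrow> ('k \<Rightarrow> real) \<Rightarrow> real"
  where "C_norm K f = Sup (insert 0 ((\<lambda>k. \<bar>f k\<bar>) ` topspace K))"

definition C_le :: "'k topology \<Rightarrow> ('k \<Rightarrow> real) \<Rightarrow> ('k \<Rightarrow> real) \<Rightarrow> bool"
  where "C_le K f g \<longleftrightarrow> (\<forall>k\<in>topspace K. f k \<le> g k)"

definition C_pos :: "'k topology \<Rightarrow> ('k \<Rightarrow> real) set"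
  where "C_pos K = {f \<in> C_space K. C_le K (\<lambda>k. 0) f}"

text \<open>\<open>T\<close> is only relevant on the cosets \<open>Q N f\<close> with \<open>f \<in> E_C\<close>.\<close>

definition linear_order_isometry_onto_sublattice ::
  "'a::real_normed_vector cb_dual set \<Rightarrow> 'k topology \<Rightarrow> ('a cb_dual set \<Rightarrow> 'k \<Rightarrow> real) \<Rightarrow> bool"
  where "linear_order_isometry_onto_sublattice N K T \<longleftrightarrow>
    (\<forall>f\<in>E_C. T (Q N f) \<in> C_space K) \<and>
    (\<forall>f\<in>E_C. \<forall>g\<in>E_C. T (Q N (f + g)) = (\<lambda>k. T (Q N f) k + T (Q N g) k)) \<and>
    (\<forall>f\<in>E_C. \<forall>c. T (Q N (c *\<^sub>R f)) = (\<lambda>k. c * T (Q N f) k)) \<and>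
    (\<forall>f\<in>E_C. C_norm K (T (Q N f)) = coset_norm (Q N f)) \<and>
    (\<forall>f\<in>E_C. \<forall>g\<in>E_C. C_le K (T (Q N f)) (T (Q N g)) \<longleftrightarrow> coset_le (Q N f) (Q N g)) \<and>
    (\<forall>f\<in>E_C. \<forall>g\<in>E_C. \<exists>h\<in>E_C. T (Q N h) = (\<lambda>k. max (T (Q N f) k) (T (Q N g) k))) \<and>
    (\<forall>f\<in>E_C. \<forall>g\<in>E_C. \<exists>h\<in>E_C. T (Q N h) = (\<lambda>k. min (T (Q N f) k) (T (Q N g) k)))"

definition TQJ :: "'a::real_normed_vector cb_dual set \<Rightarrow> ('a cb_dual set \<Rightarrow> 'k \<Rightarrow> real)
    \<Rightarrow> 'a set \<Rightarrow> 'k \<Rightarrow> real"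
  where "TQJ N T B = T (Q N (J B))"


section \<open>Measures of noncompactness\<close>

text \<open>Measures of noncompactness are total functions whose values outside \<open>bounded_sets\<close> are
  irrelevant.\<close>

definition mnc_axioms :: "('a::real_normed_vector set \<Rightarrow> real) \<Rightarrow> bool"
  where "mnc_axioms \<mu> \<longleftrightarrow>
    (\<forall>B\<in>bounded_sets. 0 \<le> \<mu> B) \<and>
    (\<forall>B\<in>bounded_sets. \<mu> B = 0 \<longleftrightarrow> compact (closure B)) \<and>
    (\<forall>A\<in>bounded_sets. \<forall>B\<in>bounded_sets. B \<subseteq> A \<longrightarrow> \<mu> B \<le> \<mu> A) \<and>
    (\<forall>B\<in>bounded_sets. \<mu> (convex hull B) = \<mu> B)"

definition convex_mnc :: "('a::real_normed_vector set \<Rightarrow> real) \<Rightarrow> bool"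
  where "convex_mnc \<mu> \<longleftrightarrow> mnc_axioms \<mu> \<and>
    (\<forall>A\<in>bounded_sets. \<forall>B\<in>bounded_sets. \<forall>l. 0 \<le> l \<and> l \<le> 1 \<longrightarrow>
       \<mu> {l *\<^sub>R a + (1 - l) *\<^sub>R b | a b. a \<in> A \<and> b \<in> B} \<le> l * \<mu> A + (1 - l) * \<mu> B)"

definition sublinear_mnc :: "('a::real_normed_vector set \<Rightarrow> real) \<Rightarrow> bool"
  where "sublinear_mnc \<mu> \<longleftrightarrow> mnc_axioms \<mu> \<and>
    (\<forall>A\<in>bounded_sets. \<forall>B\<in>bounded_sets. \<mu> {a + b | a b. a \<in> A \<and> b \<in> B} \<le> \<mu> A + \<mu> B) \<and>
    (\<forall>B\<in>bounded_sets. \<forall>k\<ge>0. \<mu> ((\<lambda>b. k *\<^sub>R b) ` B) = k * \<mu> B)"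

text \<open>The argument \<open>\<TT>\<close> stands for \<open>TQJ N T\<close>. Since functions on \<open>K\<close> form no real vector space
  type here, convexity of \<open>F\<close> and of its domain is spelled out pointwise.\<close>

definition represents_mnc :: "'k topology \<Rightarrow> ('a::real_normed_vector set \<Rightarrow> 'k \<Rightarrow> real)
    \<Rightarrow> ('a set \<Rightarrow> real) \<Rightarrow> (('k \<Rightarrow> real) \<Rightarrow> real) \<Rightarrow> bool"
  where "represents_mnc K \<TT> \<mu> F \<longleftrightarrow>
    (let V = \<TT> ` bounded_sets;
         u = \<TT> (cball 0 1);
         d = (\<lambda>f g. C_norm K (\<lambda>k. f k - g k)) in
      V \<subseteq> C_pos K \<and>
      (\<forall>B\<in>bounded_sets. \<mu> B = F (\<TT> B)) \<and>
      (\<forall>f\<in>V. 0 \<le> F f) \<and>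
      (\<forall>f\<in>V. \<forall>g\<in>V. \<forall>t. 0 \<le> t \<and> t \<le> 1 \<longrightarrow>
         (\<lambda>k. t * f k + (1 - t) * g k) \<in> V \<and>
         F (\<lambda>k. t * f k + (1 - t) * g k) \<le> t * F f + (1 - t) * F g) \<and>
      (\<forall>f\<in>V. \<forall>g\<in>V. C_le K f g \<longrightarrow> F f \<le> F g) \<and>
      (\<forall>r\<ge>0. \<forall>f\<in>V. C_norm K f \<le> r \<longrightarrow> \<bar>F f\<bar> \<le> F (\<lambda>k. r * u k)) \<and>
      (\<forall>r\<ge>0. F (\<lambda>k. (1 + r) * u k) = \<mu> ((\<lambda>x. (1 + r) *\<^sub>R x) ` cball 0 1) \<and>
         (\<forall>f\<in>V. \<forall>g\<in>V. C_norm K f \<le> r \<and> C_norm K g \<le> r \<longrightarrow>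
            \<bar>F f - F g\<bar> \<le> F (\<lambda>k. (1 + r) * u k) * d f g)) \<and>
      (sublinear_mnc \<mu> \<longrightarrow>
         (\<forall>r\<ge>0. \<forall>f\<in>V. \<forall>g\<in>V. C_norm K f \<le> r \<and> C_norm K g \<le> r \<longrightarrow>
            \<bar>F f - F g\<bar> \<le> \<mu> (cball 0 1) * d f g)))"

end

theory Submission
  imports Defs
begin

text \<open>
  If the class of \<open>J A\<close> lies below that of \<open>J B\<close> plus a constant \<open>d\<close>, then for every \<open>\<delta> > d\<close> there is a compact
  \<open>C\<close> with \<open>J A \<le> J B + J C + \<delta>\<close>, and separation puts \<open>A\<close> inside a \<open>\<delta>\<close>-neighbourhood of the convex hull of
  \<open>B + C\<close>. This uses that every element of the quotiented ideal is dominated, up to a small constant, by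
  the support function of a compact set. A convex measure of noncompactness does not see \<open>C\<close>: write
  \<open>B + C = l (B / l) + (1 - l) (C / (1 - l))\<close> and let \<open>l\<close> tend to \<open>1\<close>. With \<open>d = 0\<close> this makes \<open>F\<close> well defined
  and monotone; with \<open>d < 1\<close>, the inclusion of \<open>B + \<delta> U\<close> in \<open>(1 - \<delta>) B + \<delta> (B + U)\<close>, where \<open>U\<close> is the unit ball,
  gives the Lipschitz bound.

  For the ideal generated by \<open>E_K\<close>, take as \<open>K\<close> the lattice homomorphisms of norm at most \<open>1\<close> that
  vanish on the ideal. The Gelfand-type map is isometric because a function outside the ideal stays
  large on points where finitely many elements of the ideal are small, and these points accumulate at
  such a homomorphism.
\<close>

section \<open>Sublinear functionals and support functions\<close>

text \<open>Homogeneity is an inequality because that is what the infimum constructions below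
  deliver directly; equality is recovered in \<open>sublinear_scale\<close>.\<close>

definition sublinear :: "('a::real_vector \<Rightarrow> real) \<Rightarrow> bool"
  where "sublinear p \<longleftrightarrow> (\<forall>x y. p (x + y) \<le> p x + p y) \<and> (\<forall>x. \<forall>t\<ge>0. p (t *\<^sub>R x) \<le> t * p x)"

lemma sublinearI:
  assumes "\<And>x y. p (x + y) \<le> p x + p y" "\<And>x t. 0 \<le> t \<Longrightarrow> p (t *\<^sub>R x) \<le> t * p x"
  shows "sublinear p"
  using assms by (simp add: sublinear_def)

lemma sublinear_add: "sublinear p \<Longrightarrow> p (x + y) \<le> p x + p y"
  by (simp add: sublinear_def)

lemma sublinear_scale_le: "sublinear p \<Longrightarrow> 0 \<le> t \<Longrightarrow> p (t *\<^sub>R x) \<le> t * p x"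
  by (simp add: sublinear_def)

lemma sublinear_zero: "sublinear p \<Longrightarrow> p 0 = 0"
  using sublinear_add[of p 0 0] sublinear_scale_le[of p 0 0] by simp

lemma sublinear_minus: "sublinear p \<Longrightarrow> - p (- x) \<le> p x"
  using sublinear_add[of p x "- x"] sublinear_zero[of p] by simp

lemma sublinear_scale:
  assumes "sublinear p" "0 \<le> t"
  shows "p (t *\<^sub>R x) = t * p x"
proof (cases "t = 0")
  case True
  then show ?thesis using assms sublinear_zero by simp
next
  case False
  have "p ((1 / t) *\<^sub>R (t *\<^sub>R x)) \<le> (1 / t) * p (t *\<^sub>R x)"
    using assms by (intro sublinear_scale_le) auto
  then have "t * p x \<le> p (t *\<^sub>R x)"
    using False assms(2) by (simp add: field_simps)
  then show ?thesis
    using sublinear_scale_le[OF assms, of x] by linarith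
qed

text \<open>A linear functional below \<open>q\<close> is at least \<open>s\<close> on
  \<open>D\<close>, because \<open>q (- d) \<le> - s\<close>. The infimum defining \<open>q\<close>
  is the largest sublinear functional below \<open>p\<close> with this property.\<close>

lemma sublinear_reduce_on_convex:
  fixes p :: "'a::real_vector \<Rightarrow> real"
  assumes p: "sublinear p" and D: "convex D" "D \<noteq> {}" and s: "\<And>d. d \<in> D \<Longrightarrow> s \<le> p d"
  obtains q where "sublinear q" "\<And>x. q x \<le> p x" "\<And>d. d \<in> D \<Longrightarrow> q (- d) \<le> - s"
proof -
  define q where "q x = Inf {p (x + t *\<^sub>R d) - t * s | t d. 0 \<le> t \<and> d \<in> D}" for x
  \<comment> \<open>Here \<open>s \<le> p d\<close> enters: it bounds the set in the definition of
    \<open>q\<close> from below, so its infimum is a genuine one.\<close>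
  have lower: "- p (- x) \<le> p (x + t *\<^sub>R d) - t * s" if "0 \<le> t" "d \<in> D" for x t d
  proof -
    have "t * s \<le> p (t *\<^sub>R d)"
      using s[OF that(2)] sublinear_scale[OF p that(1)] that(1) by (simp add: mult_left_mono)
    also have "\<dots> \<le> p (x + t *\<^sub>R d) + p (- x)"
      using sublinear_add[OF p, of "x + t *\<^sub>R d" "- x"] by simp
    finally show ?thesis by simp
  qed
  have q_le: "q x \<le> p (x + t *\<^sub>R d) - t * s" if "0 \<le> t" "d \<in> D" for x t d
    unfolding q_def by (rule cInf_lower) (use that lower in \<open>auto intro!: bdd_belowI[of _ "- p (- x)"]\<close>)
  have q_greatest: "c \<le> q x" if "\<And>t d. 0 \<le> t \<Longrightarrow> d \<in> D \<Longrightarrow> c \<le> p (x + t *\<^sub>R d) - t * s" for c x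
  proof -
    obtain d where "d \<in> D" using D by auto
    then have "{p (x + t *\<^sub>R d) - t * s | t d. 0 \<le> t \<and> d \<in> D} \<noteq> {}"
      by (blast intro: order_refl[of "0::real"])
    then show ?thesis
      unfolding q_def by (rule cInf_greatest) (use that in auto)
  qed
  \<comment> \<open>Convexity of \<open>D\<close> combines two multiples of its points into a single
    one, as subadditivity of \<open>q\<close> requires. If both factors vanish, the normalized
    weights make no sense and any point serves.\<close>
  have merge: "\<exists>d''\<in>D. t *\<^sub>R d + t' *\<^sub>R d' = (t + t') *\<^sub>R d''"
    if "0 \<le> t" "d \<in> D" "0 \<le> t'" "d' \<in> D" for t t' d d'
  proof (cases "t + t' = 0")
    case True
    then have "t = 0" "t' = 0" using that by linarith+
    then show ?thesis using that by auto
  next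
    case False
    have "(t / (t + t')) *\<^sub>R d + (t' / (t + t')) *\<^sub>R d' \<in> D"
      using D(1) that False by (intro convexD) (auto simp: add_divide_distrib[symmetric])
    moreover have "t *\<^sub>R d + t' *\<^sub>R d' = (t + t') *\<^sub>R ((t / (t + t')) *\<^sub>R d + (t' / (t + t')) *\<^sub>R d')"
      using False by (simp add: scaleR_right_distrib)
    ultimately show ?thesis by blast
  qed
  obtain d0 where d0: "d0 \<in> D" using D by auto
  have q_le_p: "q x \<le> p x" for x
    using q_le[of 0 d0 x] d0 by simp
  have "sublinear q"
  proof (rule sublinearI)
    fix x y
    have "q (x + y) - (p (x + t *\<^sub>R d) - t * s) \<le> q y" if td: "0 \<le> t" "d \<in> D" for t d
    proof (rule q_greatest)
      fix t' d' assume *: "0 \<le> (t'::real)" "d' \<in> D"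
      obtain d'' where d'': "d'' \<in> D" "t *\<^sub>R d + t' *\<^sub>R d' = (t + t') *\<^sub>R d''"
        using merge[OF td *] by auto
      have "q (x + y) \<le> p (x + y + (t + t') *\<^sub>R d'') - (t + t') * s"
        using td * d'' by (intro q_le) auto
      also have "x + y + (t + t') *\<^sub>R d'' = (x + t *\<^sub>R d) + (y + t' *\<^sub>R d')"
        unfolding d''(2)[symmetric] by (simp add: ac_simps)
      also have "p \<dots> - (t + t') * s \<le> p (x + t *\<^sub>R d) + p (y + t' *\<^sub>R d') - (t + t') * s"
        using sublinear_add[OF p] by simp
      finally show "q (x + y) - (p (x + t *\<^sub>R d) - t * s) \<le> p (y + t' *\<^sub>R d') - t' * s"
        by (simp add: algebra_simps)
    qed
    then have "q (x + y) - q y \<le> q x"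
      by (intro q_greatest) (simp add: algebra_simps)
    then show "q (x + y) \<le> q x + q y" by simp
  next
    fix x and c :: real assume c: "0 \<le> c"
    show "q (c *\<^sub>R x) \<le> c * q x"
    proof (cases "c = 0")
      case True
      then show ?thesis using q_le_p[of 0] sublinear_zero[OF p] by simp
    next
      case False
      have "q (c *\<^sub>R x) / c \<le> q x"
      proof (rule q_greatest)
        fix t d assume *: "0 \<le> (t::real)" "d \<in> D"
        have "q (c *\<^sub>R x) \<le> p (c *\<^sub>R x + (c * t) *\<^sub>R d) - (c * t) * s"
          using * c by (intro q_le) auto
        also have "c *\<^sub>R x + (c * t) *\<^sub>R d = c *\<^sub>R (x + t *\<^sub>R d)"
          by (simp add: algebra_simps)
        also have "p \<dots> = c * p (x + t *\<^sub>R d)"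
          by (rule sublinear_scale[OF p c])
        finally show "q (c *\<^sub>R x) / c \<le> p (x + t *\<^sub>R d) - t * s"
          using False c by (simp add: field_simps)
      qed
      then show ?thesis using False c by (simp add: field_simps)
    qed
  qed
  moreover have "q (- d) \<le> - s" if "d \<in> D" for d
    using q_le[of 1 d "- d"] that sublinear_zero[OF p] by simp
  ultimately show ?thesis using that q_le_p by blast
qed

text \<open>Supplies the lower bounds of chains for Zorn's lemma. Subadditivity survives because the
  smaller of two members of the chain serves both arguments at once; \<open>- p (- x)\<close> keeps
  the infimum finite.\<close>

lemma sublinear_Inf_chain:
  fixes C :: "('a::real_vector \<Rightarrow> real) set"
  assumes "C \<noteq> {}" and sub: "\<And>q. q \<in> C \<Longrightarrow> sublinear q" and le: "\<And>q x. q \<in> C \<Longrightarrow> q x \<le> p x"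
    and chain: "\<And>q r. q \<in> C \<Longrightarrow> r \<in> C \<Longrightarrow> q \<le> r \<or> r \<le> q"
  shows "sublinear (\<lambda>x. INF q\<in>C. q x)" "\<And>q x. q \<in> C \<Longrightarrow> (INF q\<in>C. q x) \<le> q x"
proof -
  have lower: "- p (- x) \<le> q x" if "q \<in> C" for q x
    using sublinear_minus[OF sub[OF that], of x] le[OF that, of "- x"] by linarith
  have bdd: "bdd_below ((\<lambda>q. q x) ` C)" for x
    using lower by (auto intro!: bdd_belowI)
  show Inf_le: "(INF q\<in>C. q x) \<le> q x" if "q \<in> C" for q x
    using that bdd by (intro cINF_lower) auto
  show "sublinear (\<lambda>x. INF q\<in>C. q x)"
  proof (rule sublinearI)
    fix x y
    have "(INF q\<in>C. q (x + y)) \<le> q x + r y" if qr: "q \<in> C" "r \<in> C" for q r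
    proof -
      obtain m where m: "m \<in> C" "m \<le> q" "m \<le> r"
        using chain[OF qr] qr by auto
      have "(INF q\<in>C. q (x + y)) \<le> m (x + y)" by (rule Inf_le[OF m(1)])
      also have "\<dots> \<le> m x + m y" by (rule sublinear_add[OF sub[OF m(1)]])
      also have "\<dots> \<le> q x + r y" using m by (intro add_mono) (auto simp: le_fun_def)
      finally show ?thesis .
    qed
    then have "(INF q\<in>C. q (x + y)) - q x \<le> (INF r\<in>C. r y)" if "q \<in> C" for q
      using that \<open>C \<noteq> {}\<close> by (intro cINF_greatest) (auto simp: diff_le_eq add.commute[of _ "q x"])
    then have "(INF q\<in>C. q (x + y)) - (INF r\<in>C. r y) \<le> q x" if "q \<in> C" for q
      using that by (simp add: algebra_simps)
    then have "(INF q\<in>C. q (x + y)) - (INF r\<in>C. r y) \<le> (INF q\<in>C. q x)"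
      using \<open>C \<noteq> {}\<close> by (intro cINF_greatest)
    then show "(INF q\<in>C. q (x + y)) \<le> (INF q\<in>C. q x) + (INF q\<in>C. q y)" by simp
  next
    fix x and t :: real assume t: "0 \<le> t"
    show "(INF q\<in>C. q (t *\<^sub>R x)) \<le> t * (INF q\<in>C. q x)"
    proof (cases "t = 0")
      case True
      obtain q where "q \<in> C" using \<open>C \<noteq> {}\<close> by auto
      then show ?thesis using Inf_le[of q 0] True sublinear_zero[OF sub[of q]] by simp
    next
      case False
      have "(INF q\<in>C. q (t *\<^sub>R x)) / t \<le> (INF q\<in>C. q x)"
      proof (rule cINF_greatest[OF \<open>C \<noteq> {}\<close>])
        fix q assume q: "q \<in> C"
        then have "(INF q\<in>C. q (t *\<^sub>R x)) \<le> t * q x"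
          using Inf_le[OF q, of "t *\<^sub>R x"] sublinear_scale[OF sub[OF q] t, of x] by simp
        then show "(INF q\<in>C. q (t *\<^sub>R x)) / t \<le> q x"
          using False t by (simp add: field_simps)
      qed
      then show ?thesis using False t by (simp add: field_simps)
    qed
  qed
qed

text \<open>A minimal sublinear functional is linear, since otherwise the reduction over a singleton
  lowers it.\<close>

lemma sublinear_dominates_linear:
  fixes p :: "'a::real_vector \<Rightarrow> real"
  assumes p: "sublinear p"
  obtains f where "linear f" "\<And>x. f x \<le> p x"
proof -
  define S where "S = {q. sublinear q \<and> q \<le> p}"
  have "\<exists>q\<in>S. \<forall>r\<in>S. r \<le> q \<longrightarrow> r = q"
  \<comment> \<open>The order is reversed, so a maximal element in the sense of Zorn is a minimal
    sublinear functional.\<close>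
  proof (rule predicate_Zorn[where P = "\<lambda>q r. r \<le> q"])
    show "partial_order_on S (relation_of (\<lambda>q r. r \<le> q) S)"
      by (rule partial_order_on_relation_ofI) auto
  next
    fix C assume "C \<in> Chains (relation_of (\<lambda>q r. r \<le> q) S)"
    then have CS: "C \<subseteq> S" and chain: "\<And>q r. q \<in> C \<Longrightarrow> r \<in> C \<Longrightarrow> q \<le> r \<or> r \<le> q"
      by (auto simp: Chains_def relation_of_def)
    show "\<exists>u\<in>S. \<forall>a\<in>C. u \<le> a"
    proof (cases "C = {}")
      case True
      then show ?thesis using p by (auto simp: S_def)
    next
      case False
      have sub: "\<And>q. q \<in> C \<Longrightarrow> sublinear q" and le: "\<And>q x. q \<in> C \<Longrightarrow> q x \<le> p x"
        using CS by (auto simp: S_def le_fun_def)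
      have I: "sublinear (\<lambda>x. INF q\<in>C. q x)" "\<And>q x. q \<in> C \<Longrightarrow> (INF q\<in>C. q x) \<le> q x"
        using sublinear_Inf_chain[where C = C and p = p] False sub le chain by blast+
      obtain q where "q \<in> C" using False by auto
      then have "(INF q\<in>C. q x) \<le> p x" for x
        using I(2)[of q x] le[of q x] by linarith
      then show ?thesis
        using I by (intro bexI[of _ "\<lambda>x. INF q\<in>C. q x"]) (auto simp: S_def le_fun_def)
    qed
  qed
  then obtain q where q: "sublinear q" "q \<le> p" and min: "\<And>r. sublinear r \<Longrightarrow> r \<le> p \<Longrightarrow> r \<le> q \<Longrightarrow> r = q"
    by (auto simp: S_def)
  have minus: "q (- y) = - q y" for y
  proof -
    obtain r where r: "sublinear r" "\<And>x. r x \<le> q x" "\<And>d. d \<in> {y} \<Longrightarrow> r (- d) \<le> - q y"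
      by (rule sublinear_reduce_on_convex[OF q(1), of "{y}" "q y"]) auto
    have "r = q"
      using r q(2) by (intro min) (auto simp: le_fun_def intro: order_trans)
    then show ?thesis
      using r(3)[of y] sublinear_minus[OF q(1), of y] by simp
  qed
  have "linear q"
  proof (rule linearI)
    fix x y
    show "q (x + y) = q x + q y"
      using sublinear_add[OF q(1), of x y] sublinear_add[OF q(1), of "x + y" "- y"] minus[of y] by simp
  next
    fix c x
    show "q (c *\<^sub>R x) = c *\<^sub>R q x"
      using sublinear_scale[OF q(1), of c x] sublinear_scale[OF q(1), of "- c" x] minus[of "c *\<^sub>R x"]
      by (cases "0 \<le> c") auto
  qed
  then show ?thesis using that q(2) by (auto simp: le_fun_def)
qed

text \<open>A form of the Hahn-Banach theorem that yields domination by \<open>p\<close> and the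
  lower bound on \<open>D\<close> together: the reduction encodes the bound in \<open>q\<close>, and
  linearity of \<open>f\<close> decodes it.\<close>

theorem mazur_orlicz:
  fixes p :: "'a::real_vector \<Rightarrow> real"
  assumes "sublinear p" "convex D" "D \<noteq> {}" "\<And>d. d \<in> D \<Longrightarrow> s \<le> p d"
  obtains f where "linear f" "\<And>x. f x \<le> p x" "\<And>d. d \<in> D \<Longrightarrow> s \<le> f d"
proof -
  obtain q where q: "sublinear q" "\<And>x. q x \<le> p x" "\<And>d. d \<in> D \<Longrightarrow> q (- d) \<le> - s"
    using sublinear_reduce_on_convex[OF assms] by blast
  obtain f where f: "linear f" "\<And>x. f x \<le> q x"
    using sublinear_dominates_linear[OF q(1)] by blast
  show ?thesis
  proof (rule that[OF f(1)])
    show "f x \<le> p x" for x using f(2)[of x] q(2)[of x] by linarith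
    show "s \<le> f d" if "d \<in> D" for d
      using f(2)[of "- d"] q(3)[OF that] linear_neg[OF f(1), of d] by linarith
  qed
qed

section \<open>The dual unit ball and separation by its points\<close>

lemma norm_functional_le: "norm (functional \<omega>) \<le> 1"
  using functional[of \<omega>] by simp

lemma abs_functional_le: "\<bar>blinfun_apply (functional \<omega>) x\<bar> \<le> norm x"
proof -
  have "norm (blinfun_apply (functional \<omega>) x) \<le> norm (functional \<omega>) * norm x"
    by (rule norm_blinfun)
  also have "\<dots> \<le> 1 * norm x"
    by (intro mult_right_mono norm_functional_le) auto
  finally show ?thesis by simp
qed

lemma dual_ball_of_linear:
  fixes f :: "'a::real_normed_vector \<Rightarrow> real"
  assumes "linear f" "\<And>x. f x \<le> norm x"
  obtains \<omega> where "blinfun_apply (functional \<omega>) = f"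
proof -
  have abs: "\<bar>f x\<bar> \<le> norm x" for x
    using assms(2)[of x] assms(2)[of "- x"] linear_neg[OF assms(1), of x] by simp
  then have "bounded_linear f"
    using assms(1) by (intro bounded_linear_intro[where K = 1])
      (auto simp: linear_add linear_scale)
  then have app: "blinfun_apply (Blinfun f) = f"
    by (rule bounded_linear_Blinfun_apply)
  have "norm (Blinfun f) \<le> 1"
    using abs app by (intro norm_blinfun_bound) auto
  then have "functional (Dual_ball (Blinfun f)) = Blinfun f"
    by (intro Dual_ball_inverse) simp
  then show ?thesis using that app by metis
qed

text \<open>Taking the norm as the sublinear functional makes the separation quantitative: the
  functional has norm at most 1 and keeps the full distance \<open>s\<close>.\<close>

lemma separation_from_convex:
  fixes D :: "'a::real_normed_vector set"
  assumes "convex D" "D \<noteq> {}" "\<And>d. d \<in> D \<Longrightarrow> s \<le> norm d"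
  obtains \<omega> where "\<And>d. d \<in> D \<Longrightarrow> s \<le> blinfun_apply (functional \<omega>) d"
proof -
  have "sublinear (norm :: 'a \<Rightarrow> real)"
    by (rule sublinearI) (auto simp: norm_triangle_ineq)
  then obtain f :: "'a \<Rightarrow> real" where "linear f" "\<And>x. f x \<le> norm x" "\<And>d. d \<in> D \<Longrightarrow> s \<le> f d"
    using mazur_orlicz[where p = norm, OF _ assms] by blast
  then show ?thesis
    using dual_ball_of_linear that by metis
qed

section \<open>Stability properties of the bounded sets\<close>

lemma bounded_sets_compact: "compact C \<Longrightarrow> C \<noteq> {} \<Longrightarrow> C \<in> bounded_sets"
  by (simp add: bounded_sets_def compact_imp_bounded)

lemma bounded_sets_plus: "A \<in> bounded_sets \<Longrightarrow> B \<in> bounded_sets \<Longrightarrow> A + B \<in> bounded_sets"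
  unfolding bounded_sets_def set_plus_image by (auto intro: bounded_plus)

lemma bounded_sets_scaleR: "B \<in> bounded_sets \<Longrightarrow> (\<lambda>b. k *\<^sub>R b) ` B \<in> bounded_sets"
  by (auto simp: bounded_sets_def bounded_scaling)

lemma bounded_sets_Un: "A \<in> bounded_sets \<Longrightarrow> B \<in> bounded_sets \<Longrightarrow> A \<union> B \<in> bounded_sets"
  by (auto simp: bounded_sets_def)

lemma bounded_sets_convex_hull: "B \<in> bounded_sets \<Longrightarrow> convex hull B \<in> bounded_sets"
  by (auto simp: bounded_sets_def bounded_convex_hull)

lemma bounded_sets_closure: "B \<in> bounded_sets \<Longrightarrow> closure B \<in> bounded_sets"
  by (auto simp: bounded_sets_def)

lemma bounded_sets_cball: "0 \<le> r \<Longrightarrow> cball (x::'a::real_normed_vector) r \<in> bounded_sets"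
  by (simp add: bounded_sets_def)

lemma scaleR_cball_0:
  assumes "0 \<le> c"
  shows "(\<lambda>x. c *\<^sub>R x) ` cball (0::'a::real_normed_vector) 1 = cball 0 c"
proof (cases "c = 0")
  case True
  then show ?thesis by (auto simp: image_iff intro!: exI[of _ 0])
next
  case False
  then show ?thesis using cball_scale[of c 0 1] assms by simp
qed

section \<open>Support functions and their calculus\<close>

lemma bdd_above_functional:
  assumes "B \<in> bounded_sets"
  shows "bdd_above ((\<lambda>b. blinfun_apply (functional \<omega>) b) ` B)"
proof -
  obtain M where M: "\<And>b. b \<in> B \<Longrightarrow> norm b \<le> M"
    using assms by (auto simp: bounded_sets_def bounded_iff)
  show ?thesis
    using M abs_functional_le[of \<omega>] by (intro bdd_aboveI[of _ M]) (smt (verit) imageE)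
qed

text \<open>If \<open>M\<close> bounds the norms in \<open>B\<close>, the support function is
  \<open>M\<close>-Lipschitz for the dual norm and bounded by \<open>M\<close>. This licenses the
  inversion of \<open>Bcontfun\<close> in \<open>apply_J\<close>.\<close>

lemma support_function_in_bcontfun:
  assumes B: "B \<in> bounded_sets"
  shows "(\<lambda>\<omega>. SUP b\<in>B. blinfun_apply (functional \<omega>) b) \<in> bcontfun"
proof -
  obtain M where M: "\<And>b. b \<in> B \<Longrightarrow> norm b \<le> M" and "0 \<le> M"
    using B by (auto simp: bounded_sets_def bounded_pos intro: less_imp_le)
  obtain b0 where b0: "b0 \<in> B" using B by (auto simp: bounded_sets_def)
  note upper = cSUP_upper[OF _ bdd_above_functional[OF B]]
  have Lip: "(SUP b\<in>B. blinfun_apply (functional \<omega>) b) \<le> (SUP b\<in>B. blinfun_apply (functional \<omega>') b) + M * dist \<omega> \<omega>'"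
    for \<omega> \<omega>'
  proof (rule cSUP_least)
    fix b assume b: "b \<in> B"
    have "blinfun_apply (functional \<omega>) b - blinfun_apply (functional \<omega>') b
        = blinfun_apply (functional \<omega> - functional \<omega>') b"
      by (simp add: blinfun.diff_left)
    also have "\<dots> \<le> norm (functional \<omega> - functional \<omega>') * norm b"
      using norm_blinfun[of "functional \<omega> - functional \<omega>'" b] by simp
    also have "\<dots> \<le> dist \<omega> \<omega>' * M"
      using M[OF b] by (simp add: dist_dual_ball_def dist_norm mult_left_mono)
    finally show "blinfun_apply (functional \<omega>) b
        \<le> (SUP b\<in>B. blinfun_apply (functional \<omega>') b) + M * dist \<omega> \<omega>'"
      using upper[OF b, of \<omega>'] by (simp add: mult.commute)
  qed (use b0 in auto)
  show ?thesis
  proof (rule bcontfun_normI)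
    have "M-lipschitz_on UNIV (\<lambda>\<omega>. SUP b\<in>B. blinfun_apply (functional \<omega>) b)"
    proof (rule lipschitz_onI[OF _ \<open>0 \<le> M\<close>])
      fix \<omega> \<omega>' :: "'a dual_ball"
      show "dist (SUP b\<in>B. blinfun_apply (functional \<omega>) b) (SUP b\<in>B. blinfun_apply (functional \<omega>') b) \<le> M * dist \<omega> \<omega>'"
        using Lip[of \<omega> \<omega>'] Lip[of \<omega>' \<omega>] by (simp add: dist_real_def dist_commute abs_le_iff)
    qed
    then show "continuous_on UNIV (\<lambda>\<omega>. SUP b\<in>B. blinfun_apply (functional \<omega>) b)"
      by (rule lipschitz_on_continuous_on)
  next
    fix \<omega> :: "'a dual_ball"
    have *: "\<bar>blinfun_apply (functional \<omega>) b\<bar> \<le> M" if "b \<in> B" for b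
      using abs_functional_le[of \<omega> b] M[OF that] by linarith
    have "(SUP b\<in>B. blinfun_apply (functional \<omega>) b) \<le> M"
      using b0 * by (intro cSUP_least) (auto simp: abs_le_iff)
    moreover have "- M \<le> (SUP b\<in>B. blinfun_apply (functional \<omega>) b)"
      using upper[OF b0, of \<omega>] *[OF b0] by simp
    ultimately show "norm (SUP b\<in>B. blinfun_apply (functional \<omega>) b) \<le> M"
      by simp
  qed
qed

lemma apply_J:
  "B \<in> bounded_sets \<Longrightarrow> apply_bcontfun (J B) \<omega> = (SUP b\<in>B. blinfun_apply (functional \<omega>) b)"
  by (simp add: J_def Bcontfun_inverse support_function_in_bcontfun)

lemma J_upper: "B \<in> bounded_sets \<Longrightarrow> b \<in> B \<Longrightarrow> blinfun_apply (functional \<omega>) b \<le> J B \<omega>"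
  by (simp add: apply_J cSUP_upper bdd_above_functional)

lemma J_least:
  assumes "B \<in> bounded_sets" "\<And>b. b \<in> B \<Longrightarrow> blinfun_apply (functional \<omega>) b \<le> c"
  shows "J B \<omega> \<le> c"
  using assms by (auto simp: apply_J bounded_sets_def intro: cSUP_least)

lemma J_mono: "A \<in> bounded_sets \<Longrightarrow> B \<in> bounded_sets \<Longrightarrow> A \<subseteq> B \<Longrightarrow> J A \<omega> \<le> J B \<omega>"
  by (auto intro!: J_least J_upper)

lemma J_plus:
  assumes A: "A \<in> bounded_sets" and B: "B \<in> bounded_sets"
  shows "J (A + B) = J A + J B"
proof (rule bcontfun_eqI)
  fix \<omega>
  note AB = bounded_sets_plus[OF A B]
  have "J (A + B) \<omega> \<le> J A \<omega> + J B \<omega>"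
    using A B by (intro J_least[OF AB]) (auto elim!: set_plus_elim simp: blinfun.add_right intro!: add_mono J_upper)
  moreover have "J A \<omega> \<le> J (A + B) \<omega> - J B \<omega>"
  proof (rule J_least[OF A])
    fix a assume a: "a \<in> A"
    have "J B \<omega> \<le> J (A + B) \<omega> - blinfun_apply (functional \<omega>) a"
    proof (rule J_least[OF B])
      fix b assume "b \<in> B"
      then show "blinfun_apply (functional \<omega>) b \<le> J (A + B) \<omega> - blinfun_apply (functional \<omega>) a"
        using J_upper[OF AB, of "a + b" \<omega>] a by (simp add: blinfun.add_right set_plus_intro)
    qed
    then show "blinfun_apply (functional \<omega>) a \<le> J (A + B) \<omega> - J B \<omega>" by simp
  qed
  ultimately show "J (A + B) \<omega> = (J A + J B) \<omega>" by simp
qed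

lemma J_scaleR:
  assumes B: "B \<in> bounded_sets" and c: "0 \<le> c"
  shows "J ((\<lambda>b. c *\<^sub>R b) ` B) = c *\<^sub>R J B"
proof (rule bcontfun_eqI)
  fix \<omega>
  note cB = bounded_sets_scaleR[OF B, of c]
  have "J ((\<lambda>b. c *\<^sub>R b) ` B) \<omega> \<le> c * J B \<omega>"
    using c by (intro J_least[OF cB]) (auto simp: blinfun.scaleR_right intro!: mult_left_mono J_upper[OF B])
  moreover have "c * J B \<omega> \<le> J ((\<lambda>b. c *\<^sub>R b) ` B) \<omega>"
  proof (cases "c = 0")
    case True
    then show ?thesis
      using J_upper[OF cB, of 0 \<omega>] B by (auto simp: bounded_sets_def)
  next
    case False
    have "J B \<omega> \<le> J ((\<lambda>b. c *\<^sub>R b) ` B) \<omega> / c"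
    proof (rule J_least[OF B])
      fix b assume "b \<in> B"
      then show "blinfun_apply (functional \<omega>) b \<le> J ((\<lambda>b. c *\<^sub>R b) ` B) \<omega> / c"
        using J_upper[OF cB, of "c *\<^sub>R b" \<omega>] False c by (simp add: blinfun.scaleR_right field_simps)
    qed
    then show ?thesis using False c by (simp add: field_simps)
  qed
  ultimately show "J ((\<lambda>b. c *\<^sub>R b) ` B) \<omega> = (c *\<^sub>R J B) \<omega>" by simp
qed

lemma J_Un:
  assumes A: "A \<in> bounded_sets" and B: "B \<in> bounded_sets"
  shows "J (A \<union> B) \<omega> = max (J A \<omega>) (J B \<omega>)"
proof (rule antisym)
  show "J (A \<union> B) \<omega> \<le> max (J A \<omega>) (J B \<omega>)"
    using J_upper[OF A] J_upper[OF B]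
    by (intro J_least bounded_sets_Un A B) (auto simp: le_max_iff_disj)
  show "max (J A \<omega>) (J B \<omega>) \<le> J (A \<union> B) \<omega>"
    using J_mono[OF A bounded_sets_Un[OF A B]] J_mono[OF B bounded_sets_Un[OF A B]] by auto
qed

text \<open>A closed half-space that contains \<open>B\<close> also contains its closed convex
  hull.\<close>

lemma J_closed_convex_hull:
  assumes B: "B \<in> bounded_sets"
  shows "J (closure (convex hull B)) = J B"
proof (rule bcontfun_eqI)
  fix \<omega>
  let ?H = "{x. blinfun_apply (functional \<omega>) x \<le> J B \<omega>}"
  note clB = bounded_sets_closure[OF bounded_sets_convex_hull[OF B]]
  have "closed ?H"
    by (intro closed_Collect_le continuous_intros)
  moreover have "convex ?H"
  proof (rule convexI)
    fix x y and u v :: real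
    assume *: "x \<in> ?H" "y \<in> ?H" "0 \<le> u" "0 \<le> v" "u + v = 1"
    have "u * blinfun_apply (functional \<omega>) x + v * blinfun_apply (functional \<omega>) y
        \<le> u * J B \<omega> + v * J B \<omega>"
      using * by (intro add_mono mult_left_mono) auto
    also have "\<dots> = J B \<omega>" using *(5) by (simp add: distrib_right[symmetric])
    finally show "u *\<^sub>R x + v *\<^sub>R y \<in> ?H" by (simp add: blinfun.add_right blinfun.scaleR_right)
  qed
  moreover have "B \<subseteq> ?H" using J_upper[OF B] by auto
  ultimately have "closure (convex hull B) \<subseteq> ?H"
    by (intro closure_minimal hull_minimal) auto
  then have "J (closure (convex hull B)) \<omega> \<le> J B \<omega>"
    by (intro J_least[OF clB]) auto
  moreover have "J B \<omega> \<le> J (closure (convex hull B)) \<omega>"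
    by (intro J_mono B clB order_trans[OF hull_subset closure_subset])
  ultimately show "J (closure (convex hull B)) \<omega> = J B \<omega>" by simp
qed

lemma J_convex_hull:
  assumes B: "B \<in> bounded_sets"
  shows "J (convex hull B) = J B"
  using J_closed_convex_hull[OF bounded_sets_convex_hull[OF B]] J_closed_convex_hull[OF B]
  by (simp add: hull_hull)

lemma J_singleton: "J {x} \<omega> = blinfun_apply (functional \<omega>) x"
  by (simp add: apply_J bounded_sets_def)

lemma J_zero: "J {0} = 0"
  by (rule bcontfun_eqI) (simp add: J_singleton)

text \<open>A point \<open>a\<close> outside the neighbourhood has distance at least \<delta> from
  \<open>D\<close>; separating \<open>a - D\<close> from the origin gives a functional whose
  supremum over \<open>D\<close> is at most its value at \<open>a\<close> minus \<delta>. The gap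
  \<open>e < \<delta>\<close> allows \<open>D\<close> not to be closed and distances not to be
  attained.\<close>

lemma subset_of_J_le:
  fixes A D :: "'a::real_normed_vector set"
  assumes A: "A \<in> bounded_sets" and D: "D \<in> bounded_sets" "convex D"
    and le: "\<And>\<omega>. J A \<omega> \<le> J D \<omega> + e" and "e < \<delta>"
  shows "A \<subseteq> D + cball 0 \<delta>"
proof
  fix a assume a: "a \<in> A"
  show "a \<in> D + cball 0 \<delta>"
  proof (rule ccontr)
    assume no: "a \<notin> D + cball 0 \<delta>"
    have far: "\<delta> \<le> norm d" if "d \<in> (\<lambda>d. a - d) ` D" for d
    proof (rule ccontr)
      assume "\<not> \<delta> \<le> norm d"
      moreover from that have "a - d \<in> D" by auto
      ultimately have "(a - d) + d \<in> D + cball 0 \<delta>"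
        by (intro set_plus_intro) auto
      then show False using no by simp
    qed
    have "(\<lambda>d. a - d) ` D = (\<lambda>x. a + x) ` uminus ` D"
      by (simp add: image_image)
    then have "convex ((\<lambda>d. a - d) ` D)"
      using convex_translation[OF convex_negations[OF D(2)], of a] by simp
    moreover have "(\<lambda>d. a - d) ` D \<noteq> {}" using D(1) by (auto simp: bounded_sets_def)
    ultimately obtain \<omega> where \<omega>: "\<And>d. d \<in> (\<lambda>d. a - d) ` D \<Longrightarrow> \<delta> \<le> blinfun_apply (functional \<omega>) d"
      using separation_from_convex[of "(\<lambda>d. a - d) ` D" \<delta>] far by blast
    have "J D \<omega> \<le> blinfun_apply (functional \<omega>) a - \<delta>"
    proof (rule J_least[OF D(1)])
      fix d assume "d \<in> D"
      then show "blinfun_apply (functional \<omega>) d \<le> blinfun_apply (functional \<omega>) a - \<delta>"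
        using \<omega>[of "a - d"] by (simp add: blinfun.diff_right)
    qed
    then show False
      using J_upper[OF A a, of \<omega>] le[of \<omega>] \<open>e < \<delta>\<close> by linarith
  qed
qed

section \<open>Domination up to compact sets\<close>

text \<open>An explicit closed lattice ideal around \<open>E_K\<close>, serving as an upper bound
  for the abstractly generated \<open>E_K_ideal\<close>. The tolerance \<open>e\<close> is what
  makes it norm closed.\<close>

definition compactly_dominated :: "'a::real_normed_vector cb_dual set"
  where "compactly_dominated = {f \<in> E_C. \<forall>e>0. \<exists>C. compact C \<and> C \<noteq> {} \<and> (\<forall>\<omega>. \<bar>apply_bcontfun f \<omega>\<bar> \<le> J C \<omega> + e)}"

lemma compact_set_plus:
  fixes S T :: "'a::real_normed_vector set"
  assumes "compact S" "compact T"
  shows "compact (S + T)"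
proof -
  have "S + T = {x + y | x y. x \<in> S \<and> y \<in> T}" by (auto simp: set_plus_def)
  then show ?thesis using compact_sums[OF assms] by simp
qed

text \<open>\<open>J\<close> does not distinguish a set from its closed convex hull. Hence sums,
  dilates and unions can be used below without first making them closed and convex.\<close>

lemma E_C_eq: "E_C = closure {J A - J B | A B :: 'a::real_normed_vector set. A \<in> bounded_sets \<and> B \<in> bounded_sets}"
proof -
  have "J ` closed_bounded_convex_sets = J ` (bounded_sets :: 'a set set)"
  proof (intro equalityI subsetI)
    fix f assume "f \<in> J ` (bounded_sets :: 'a set set)"
    then obtain B :: "'a set" where B: "B \<in> bounded_sets" "f = J B" by auto
    have "closure (convex hull B) \<in> closed_bounded_convex_sets"
      using bounded_sets_closure[OF bounded_sets_convex_hull[OF B(1)]]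
      by (simp add: closed_bounded_convex_sets_def bounded_sets_def convex_closure)
    then show "f \<in> J ` closed_bounded_convex_sets"
      using J_closed_convex_hull[OF B(1)] B(2) by (metis imageI)
  qed (auto simp: closed_bounded_convex_sets_def bounded_sets_def)
  moreover have "{J A - J B | A B. A \<in> S \<and> B \<in> S} = (\<lambda>(f, g). f - g) ` (J ` S \<times> J ` S)" for S :: "'a set set"
    by auto
  ultimately show ?thesis by (simp add: E_C_def)
qed

lemma closed_E_C: "closed E_C"
  by (simp add: E_C_def)

lemma J_diff_in_E_C: "A \<in> bounded_sets \<Longrightarrow> B \<in> bounded_sets \<Longrightarrow> J A - J B \<in> E_C"
  unfolding E_C_eq by (rule subsetD[OF closure_subset]) auto

lemma J_in_E_C: "B \<in> bounded_sets \<Longrightarrow> J B \<in> E_C"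
  using J_diff_in_E_C[of B "{0}"] by (simp add: J_zero bounded_sets_def)

lemma J_singleton_in_E_K: "J {x} \<in> E_K"
proof -
  have "J {x} - J {0} \<in> E_K"
    unfolding E_K_def
    by (rule subsetD[OF closure_subset]) (auto simp: compact_convex_sets_def intro!: exI[of _ "{_}"])
  then show ?thesis by (simp add: J_zero)
qed

lemma subspace_closure:
  fixes S :: "'a::real_normed_vector set"
  assumes "subspace S"
  shows "subspace (closure S)"
  unfolding subspace_def
proof (intro conjI ballI allI)
  show "0 \<in> closure S"
    using assms closure_subset subspace_0 by blast
next
  fix x y assume "x \<in> closure S" "y \<in> closure S"
  then obtain u v where "\<And>n. u n \<in> S" "u \<longlonglongrightarrow> x" "\<And>n. v n \<in> S" "v \<longlonglongrightarrow> y"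
    unfolding closure_sequential by blast
  then show "x + y \<in> closure S"
    unfolding closure_sequential using assms
    by (intro exI[of _ "\<lambda>n. u n + v n"]) (auto intro: tendsto_add subspace_add)
next
  fix x c assume "x \<in> closure S"
  then obtain u where "\<And>n. u n \<in> S" "u \<longlonglongrightarrow> x"
    unfolding closure_sequential by blast
  then show "c *\<^sub>R x \<in> closure S"
    unfolding closure_sequential using assms
    by (intro exI[of _ "\<lambda>n. c *\<^sub>R u n"]) (auto intro: tendsto_scaleR subspace_scale)
qed

lemma subspace_J_diff:
  "subspace {J A - J B | A B :: 'a::real_normed_vector set. A \<in> bounded_sets \<and> B \<in> bounded_sets}"
    (is "subspace ?D")
  unfolding subspace_def
proof (intro conjI ballI allI)
  have "{0} \<in> (bounded_sets :: 'a set set)" by (simp add: bounded_sets_def)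
  then show "0 \<in> ?D" by force
next
  fix x y assume "x \<in> ?D" "y \<in> ?D"
  then obtain A B C D :: "'a set" where *: "x = J A - J B" "y = J C - J D"
    "A \<in> bounded_sets" "B \<in> bounded_sets" "C \<in> bounded_sets" "D \<in> bounded_sets" by auto
  have "x + y = J (A + C) - J (B + D)"
    using * by (simp add: J_plus)
  then show "x + y \<in> ?D" using * by (blast intro: bounded_sets_plus)
next
  fix x and c :: real assume "x \<in> ?D"
  then obtain A B :: "'a set" where *: "x = J A - J B" "A \<in> bounded_sets" "B \<in> bounded_sets"
    by auto
  have eq: "c *\<^sub>R x = J ((\<lambda>x. c *\<^sub>R x) ` A) - J ((\<lambda>x. c *\<^sub>R x) ` B)" if "0 \<le> c"
    using * that by (simp add: J_scaleR scaleR_right_diff_distrib)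
  \<comment> \<open>A negative factor interchanges the two sets, since \<open>J_scaleR\<close>
    covers only nonnegative factors.\<close>
  have eq': "c *\<^sub>R x = J ((\<lambda>x. (- c) *\<^sub>R x) ` B) - J ((\<lambda>x. (- c) *\<^sub>R x) ` A)" if "\<not> 0 \<le> c"
    using * that by (simp only: J_scaleR neg_0_le_iff_le) (simp add: J_scaleR scaleR_right_diff_distrib)
  show "c *\<^sub>R x \<in> ?D"
    using eq eq' bounded_sets_scaleR[of A] bounded_sets_scaleR[of B] * by blast
qed

lemma subspace_E_C: "subspace E_C"
  unfolding E_C_eq by (rule subspace_closure[OF subspace_J_diff])

text \<open>The union of a compact set with its negative is compact, and its support function
  dominates both the original support function and its negative. The witness is the sum of the two
  symmetrized sets.\<close>

lemma J_diff_compactly_bounded: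
  fixes A B :: "'a::real_normed_vector set"
  assumes "compact A" "A \<noteq> {}" "compact B" "B \<noteq> {}"
  obtains C where "compact C" "C \<noteq> {}" "\<And>\<omega>. \<bar>J A \<omega> - J B \<omega>\<bar> \<le> J C \<omega>"
proof -
  have bound: "compact (S \<union> uminus ` S)" "S \<union> uminus ` S \<noteq> {}" "\<bar>J S \<omega>\<bar> \<le> J (S \<union> uminus ` S) \<omega>"
    if S: "compact S" "S \<noteq> {}" for S :: "'a set" and \<omega>
  proof -
    show cpt: "compact (S \<union> uminus ` S)" and ne: "S \<union> uminus ` S \<noteq> {}"
      using S by (auto intro: compact_negations)
    note bs = bounded_sets_compact[OF S] bounded_sets_compact[OF cpt ne]
    obtain s where s: "s \<in> S" using S by auto
    have "- J S \<omega> \<le> blinfun_apply (functional \<omega>) (- s)"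
      using J_upper[OF bs(1) s, of \<omega>] by (simp add: blinfun.minus_right)
    also have "\<dots> \<le> J (S \<union> uminus ` S) \<omega>" using s by (intro J_upper[OF bs(2)]) auto
    finally show "\<bar>J S \<omega>\<bar> \<le> J (S \<union> uminus ` S) \<omega>"
      using J_mono[OF bs, of \<omega>] by (simp add: abs_le_iff)
  qed
  let ?A = "A \<union> uminus ` A" and ?B = "B \<union> uminus ` B"
  show ?thesis
  proof (rule that)
    show "compact (?A + ?B)" using assms by (intro compact_set_plus bound)
    show "?A + ?B \<noteq> {}" using assms by (auto simp: set_plus_def)
    fix \<omega>
    have "J (?A + ?B) = J ?A + J ?B"
      using assms by (intro J_plus bounded_sets_compact bound)
    then show "\<bar>J A \<omega> - J B \<omega>\<bar> \<le> J (?A + ?B) \<omega>"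
      using bound(3)[OF assms(1,2), of \<omega>] bound(3)[OF assms(3,4), of \<omega>] by simp
  qed
qed

section \<open>The explicit closed lattice ideal containing \<open>E_K\<close>\<close>

lemma compactly_dominatedD:
  assumes "f \<in> compactly_dominated" "0 < e"
  shows "\<exists>C. compact C \<and> C \<noteq> {} \<and> (\<forall>\<omega>. \<bar>apply_bcontfun f \<omega>\<bar> \<le> J C \<omega> + e)"
  using assms unfolding compactly_dominated_def by blast

lemma closed_compactly_dominated: "closed compactly_dominated"
  unfolding closed_sequential_limits
proof (intro allI impI)
  fix u :: "nat \<Rightarrow> 'a cb_dual" and f assume "(\<forall>n. u n \<in> compactly_dominated) \<and> u \<longlonglongrightarrow> f"
  then have u: "\<And>n. u n \<in> compactly_dominated" and lim: "u \<longlonglongrightarrow> f" by auto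
  have "\<And>n. u n \<in> E_C" using u by (simp add: compactly_dominated_def)
  then have "f \<in> E_C"
    using closed_E_C lim closed_sequentially by blast
  moreover have "\<exists>C. compact C \<and> C \<noteq> {} \<and> (\<forall>\<omega>. \<bar>apply_bcontfun f \<omega>\<bar> \<le> J C \<omega> + e)" if e: "0 < e" for e
  proof -
    obtain n where n: "dist (u n) f < e / 2"
      using lim[unfolded lim_sequentially, rule_format, OF half_gt_zero[OF e]] by blast
    obtain C where C: "compact C" "C \<noteq> {}" "\<And>\<omega>. \<bar>apply_bcontfun (u n) \<omega>\<bar> \<le> J C \<omega> + e / 2"
      using compactly_dominatedD[OF u[of n], of "e / 2"] half_gt_zero[OF e] by blast
    have "\<bar>apply_bcontfun f \<omega>\<bar> \<le> J C \<omega> + e" for \<omega>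
      using C(3)[of \<omega>] dist_bounded[of "u n" \<omega> f] n by (simp add: dist_real_def)
    then show ?thesis using C by blast
  qed
  ultimately show "f \<in> compactly_dominated" by (simp add: compactly_dominated_def)
qed

lemma subspace_compactly_dominated: "subspace (compactly_dominated :: 'a::real_normed_vector cb_dual set)"
  unfolding subspace_def
proof (intro conjI ballI allI)
  show "0 \<in> (compactly_dominated :: 'a cb_dual set)"
    unfolding compactly_dominated_def
    by (auto simp: subspace_0[OF subspace_E_C] J_zero intro!: exI[of _ "{0}"])
next
  fix x y :: "'a cb_dual" assume xy: "x \<in> compactly_dominated" "y \<in> compactly_dominated"
  have "\<exists>C. compact C \<and> C \<noteq> {} \<and> (\<forall>\<omega>. \<bar>(x + y) \<omega>\<bar> \<le> J C \<omega> + e)" if "0 < e" for e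
  proof -
    from that have "0 < e / 2" by simp
    obtain C where C: "compact C" "C \<noteq> {}" "\<And>\<omega>. \<bar>x \<omega>\<bar> \<le> J C \<omega> + e / 2"
      using compactly_dominatedD[OF xy(1) \<open>0 < e / 2\<close>] by blast
    obtain D where D: "compact D" "D \<noteq> {}" "\<And>\<omega>. \<bar>y \<omega>\<bar> \<le> J D \<omega> + e / 2"
      using compactly_dominatedD[OF xy(2) \<open>0 < e / 2\<close>] by blast
    have "J (C + D) = J C + J D"
      using C D by (intro J_plus bounded_sets_compact)
    then have "\<bar>(x + y) \<omega>\<bar> \<le> J (C + D) \<omega> + e" for \<omega>
      using C(3)[of \<omega>] D(3)[of \<omega>] by simp
    moreover have "compact (C + D)" using C D by (intro compact_set_plus)
    moreover have "C + D \<noteq> {}" using C(2) D(2) by (simp add: set_plus_image)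
    ultimately show ?thesis by blast
  qed
  then show "x + y \<in> compactly_dominated"
    using xy subspace_add[OF subspace_E_C] by (auto simp: compactly_dominated_def)
next
  fix x :: "'a cb_dual" and c assume x: "x \<in> compactly_dominated"
  have "\<exists>C. compact C \<and> C \<noteq> {} \<and> (\<forall>\<omega>. \<bar>(c *\<^sub>R x) \<omega>\<bar> \<le> J C \<omega> + e)" if "0 < e" for e
  proof -
    \<comment> \<open>Adding 1 to the denominator avoids division by zero when \<open>c\<close> is
      0.\<close>
    have "0 < e / (\<bar>c\<bar> + 1)" using that by simp
    then obtain C where C: "compact C" "C \<noteq> {}" "\<And>\<omega>. \<bar>x \<omega>\<bar> \<le> J C \<omega> + e / (\<bar>c\<bar> + 1)"
      using compactly_dominatedD[OF x] by blast
    have "\<bar>(c *\<^sub>R x) \<omega>\<bar> \<le> J ((\<lambda>x. \<bar>c\<bar> *\<^sub>R x) ` C) \<omega> + e" for \<omega>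
    proof -
      have "\<bar>c * x \<omega>\<bar> \<le> \<bar>c\<bar> * (J C \<omega> + e / (\<bar>c\<bar> + 1))"
        using C(3)[of \<omega>] by (simp add: abs_mult mult_left_mono)
      moreover have "\<bar>c\<bar> * (e / (\<bar>c\<bar> + 1)) \<le> e"
        using that by (simp add: field_simps)
      ultimately show ?thesis
        using J_scaleR[OF bounded_sets_compact[OF C(1,2)], of "\<bar>c\<bar>"] by (simp add: distrib_left)
    qed
    moreover have "compact ((\<lambda>x. \<bar>c\<bar> *\<^sub>R x) ` C)" using C by (intro compact_scaling)
    ultimately show ?thesis using C by blast
  qed
  then show "c *\<^sub>R x \<in> compactly_dominated"
    using x subspace_scale[OF subspace_E_C] by (auto simp: compactly_dominated_def)
qed

lemma E_K_compactly_dominated: "E_K \<subseteq> compactly_dominated"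
  unfolding E_K_def
proof (rule closure_minimal[OF _ closed_compactly_dominated], safe)
  fix A B :: "'a set" assume AB: "A \<in> compact_convex_sets" "B \<in> compact_convex_sets"
  then have cpt: "compact A" "A \<noteq> {}" "compact B" "B \<noteq> {}"
    by (auto simp: compact_convex_sets_def)
  obtain C where C: "compact C" "C \<noteq> {}" "\<And>\<omega>. \<bar>J A \<omega> - J B \<omega>\<bar> \<le> J C \<omega>"
    using J_diff_compactly_bounded[OF cpt] by blast
  have "\<bar>(J A - J B) \<omega>\<bar> \<le> J C \<omega> + e" if "0 < e" for e \<omega>
    using C(3)[of \<omega>] that by simp
  then show "J A - J B \<in> compactly_dominated"
    using C(1,2) J_diff_in_E_C[of A B] bounded_sets_compact cpt unfolding compactly_dominated_def by blast
qed

lemma closed_lattice_ideal_compactly_dominated: "closed_lattice_ideal compactly_dominated"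
  unfolding closed_lattice_ideal_def
proof (intro conjI closed_compactly_dominated subspace_compactly_dominated ballI impI)
  show "compactly_dominated \<subseteq> E_C" by (auto simp: compactly_dominated_def)
next
  fix f g :: "'a cb_dual" assume *: "f \<in> E_C" "g \<in> compactly_dominated" "\<forall>\<omega>. \<bar>f \<omega>\<bar> \<le> \<bar>g \<omega>\<bar>"
  have "\<exists>C. compact C \<and> C \<noteq> {} \<and> (\<forall>\<omega>. \<bar>f \<omega>\<bar> \<le> J C \<omega> + e)" if "0 < e" for e
    using compactly_dominatedD[OF *(2) that] *(3) by (meson order_trans)
  then show "f \<in> compactly_dominated" using *(1) by (simp add: compactly_dominated_def)
qed

text \<open>\<open>compactly_dominated\<close> is one of the ideals whose intersection is
  \<open>E_K_ideal\<close>, so every element of the latter is controlled by compact sets.\<close>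

lemma E_K_ideal_compactly_dominated: "E_K_ideal \<subseteq> compactly_dominated"
  unfolding E_K_ideal_def using closed_lattice_ideal_compactly_dominated E_K_compactly_dominated by auto

lemma E_K_subset_E_K_ideal: "E_K \<subseteq> E_K_ideal"
  unfolding E_K_ideal_def by auto

text \<open>All closure properties pass to intersections. Inclusion in \<open>E_C\<close> rests on
  the family being nonempty, which \<open>compactly_dominated\<close> ensures.\<close>

lemma closed_lattice_ideal_E_K_ideal: "closed_lattice_ideal E_K_ideal"
proof -
  let ?F = "{I. closed_lattice_ideal I \<and> (E_K :: 'a cb_dual set) \<subseteq> I}"
  have mem: "compactly_dominated \<in> ?F"
    using closed_lattice_ideal_compactly_dominated E_K_compactly_dominated by simp
  show ?thesis
    unfolding closed_lattice_ideal_def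
  proof (intro conjI)
    show "E_K_ideal \<subseteq> E_C"
      using E_K_ideal_compactly_dominated by (auto simp: compactly_dominated_def)
    show "closed E_K_ideal"
      unfolding E_K_ideal_def by (rule closed_Inter) (auto simp: closed_lattice_ideal_def)
    show "subspace E_K_ideal"
      unfolding E_K_ideal_def by (rule subspace_Inter) (auto simp: closed_lattice_ideal_def)
    show "\<forall>f\<in>E_C. \<forall>g\<in>E_K_ideal. (\<forall>\<omega>. \<bar>apply_bcontfun f \<omega>\<bar> \<le> \<bar>apply_bcontfun g \<omega>\<bar>) \<longrightarrow> f \<in> E_K_ideal"
      unfolding E_K_ideal_def closed_lattice_ideal_def by blast
  qed
qed

text \<open>What an order or norm relation in the quotient leaves for the measures to use, with
  elements of the ideal traded for a compact set. The estimates on measures are thereby independent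
  of the quotient and of its representation on \<open>K\<close>.\<close>

definition compactly_below :: "'a::real_normed_vector set \<Rightarrow> 'a set \<Rightarrow> real \<Rightarrow> bool"
  where "compactly_below A B d \<longleftrightarrow>
    (\<forall>e>0. \<exists>C. compact C \<and> C \<noteq> {} \<and> (\<forall>\<omega>. J A \<omega> \<le> J B \<omega> + J C \<omega> + d + e))"

lemma compactly_belowI:
  assumes "\<And>e. 0 < e \<Longrightarrow> \<exists>f\<in>compactly_dominated. \<forall>\<omega>. J A \<omega> \<le> J B \<omega> + f \<omega> + d + e"
  shows "compactly_below A B d"
  unfolding compactly_below_def
proof (intro allI impI)
  fix e :: real assume "0 < e"
  then have e: "0 < e / 2" by simp
  obtain f where f: "f \<in> compactly_dominated" "\<And>\<omega>. J A \<omega> \<le> J B \<omega> + f \<omega> + d + e / 2"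
    using assms[OF e] by blast
  obtain C where C: "compact C" "C \<noteq> {}" "\<And>\<omega>. \<bar>apply_bcontfun f \<omega>\<bar> \<le> J C \<omega> + e / 2"
    using compactly_dominatedD[OF f(1) e] by blast
  have "J A \<omega> \<le> J B \<omega> + J C \<omega> + d + e" for \<omega>
    using C(3)[of \<omega>] f(2)[of \<omega>] by linarith
  then show "\<exists>C. compact C \<and> C \<noteq> {} \<and> (\<forall>\<omega>. J A \<omega> \<le> J B \<omega> + J C \<omega> + d + e)"
    using C by blast
qed

section \<open>Convex measures of noncompactness\<close>

lemma sum_set_eq: "{a + b | a b. a \<in> A \<and> b \<in> B} = A + B"
  by (auto simp: set_plus_def)

lemma sum_scaleR_set_eq:
  "{l *\<^sub>R a + m *\<^sub>R b | a b. a \<in> A \<and> b \<in> B} = (\<lambda>a. l *\<^sub>R a) ` A + (\<lambda>b. m *\<^sub>R b) ` B"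
  by (auto simp: set_plus_def)

text \<open>Passage to the limit as \<open>e\<close> tends to 0 from the right; the restriction
  \<open>e < 1\<close> keeps \<open>e\<close> usable as a convex weight.\<close>

lemma le_of_small_multiples:
  fixes x y c :: real
  assumes "\<And>e. 0 < e \<Longrightarrow> e < 1 \<Longrightarrow> x \<le> y + e * c"
  shows "x \<le> y"
proof -
  have "((\<lambda>e. y + e * c) \<longlongrightarrow> y + 0 * c) (at_right 0)"
    by (intro tendsto_intros)
  moreover have "\<forall>\<^sub>F e in at_right 0. x \<le> y + e * c"
    using assms eventually_at_right_real[of 0 1] by (auto elim: eventually_mono)
  ultimately have "x \<le> y + 0 * c"
    by (rule tendsto_lowerbound) simp
  then show ?thesis by simp
qed

context
  fixes \<mu> :: "'a::real_normed_vector set \<Rightarrow> real"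
  assumes mnc: "convex_mnc \<mu>"
begin

lemma mnc_nonneg: "B \<in> bounded_sets \<Longrightarrow> 0 \<le> \<mu> B"
  using mnc by (simp add: convex_mnc_def mnc_axioms_def)

lemma mnc_mono: "A \<in> bounded_sets \<Longrightarrow> B \<in> bounded_sets \<Longrightarrow> A \<subseteq> B \<Longrightarrow> \<mu> A \<le> \<mu> B"
  using mnc by (simp add: convex_mnc_def mnc_axioms_def)

lemma mnc_convex_hull: "B \<in> bounded_sets \<Longrightarrow> \<mu> (convex hull B) = \<mu> B"
  using mnc by (simp add: convex_mnc_def mnc_axioms_def)

lemma mnc_compact: "compact C \<Longrightarrow> C \<noteq> {} \<Longrightarrow> \<mu> C = 0"
  using mnc bounded_sets_compact[of C]
  by (auto simp: convex_mnc_def mnc_axioms_def compact_imp_closed closure_closed)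

text \<open>Merges monotonicity with the convexity axiom, so that each application reduces to
  checking one inclusion.\<close>

lemma mnc_le_convex_combination:
  assumes "S \<in> bounded_sets" "A \<in> bounded_sets" "B \<in> bounded_sets" "0 \<le> l" "l \<le> 1"
    and "S \<subseteq> (\<lambda>a. l *\<^sub>R a) ` A + (\<lambda>b. (1 - l) *\<^sub>R b) ` B"
  shows "\<mu> S \<le> l * \<mu> A + (1 - l) * \<mu> B"
proof -
  have "\<mu> S \<le> \<mu> ((\<lambda>a. l *\<^sub>R a) ` A + (\<lambda>b. (1 - l) *\<^sub>R b) ` B)"
    using assms by (intro mnc_mono bounded_sets_plus bounded_sets_scaleR)
  also have "\<dots> \<le> l * \<mu> A + (1 - l) * \<mu> B"
    using mnc assms unfolding convex_mnc_def sum_scaleR_set_eq by blast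
  finally show ?thesis .
qed

text \<open>Since \<open>r + e = e * (r + 1) + (1 - e) * r\<close>, convexity along the ray of
  dilates gives an upper bound that tends to the value at \<open>r\<close> as \<open>e\<close> tends
  to 0.\<close>

lemma mnc_scale_interpolate:
  assumes B: "B \<in> bounded_sets" and e: "0 \<le> e" "e \<le> 1"
  shows "\<mu> ((\<lambda>b. (r + e) *\<^sub>R b) ` B) \<le> \<mu> ((\<lambda>b. r *\<^sub>R b) ` B) + e * \<mu> ((\<lambda>b. (r + 1) *\<^sub>R b) ` B)"
proof -
  have "\<mu> ((\<lambda>b. (r + e) *\<^sub>R b) ` B)
      \<le> e * \<mu> ((\<lambda>b. (r + 1) *\<^sub>R b) ` B) + (1 - e) * \<mu> ((\<lambda>b. r *\<^sub>R b) ` B)"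
  proof (rule mnc_le_convex_combination)
    show "(\<lambda>b. (r + e) *\<^sub>R b) ` B
        \<subseteq> (\<lambda>a. e *\<^sub>R a) ` (\<lambda>b. (r + 1) *\<^sub>R b) ` B + (\<lambda>b. (1 - e) *\<^sub>R b) ` (\<lambda>b. r *\<^sub>R b) ` B"
    proof clarify
      fix b assume "b \<in> B"
      then have "e *\<^sub>R (r + 1) *\<^sub>R b + (1 - e) *\<^sub>R r *\<^sub>R b
          \<in> (\<lambda>a. e *\<^sub>R a) ` (\<lambda>b. (r + 1) *\<^sub>R b) ` B + (\<lambda>b. (1 - e) *\<^sub>R b) ` (\<lambda>b. r *\<^sub>R b) ` B"
        by (intro set_plus_intro imageI)
      also have "e *\<^sub>R (r + 1) *\<^sub>R b + (1 - e) *\<^sub>R r *\<^sub>R b = (e * (r + 1) + (1 - e) * r) *\<^sub>R b"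
        by (simp add: scaleR_left_distrib[symmetric] del: scaleR_left_distrib)
      also have "e * (r + 1) + (1 - e) * r = r + e" by (simp add: algebra_simps)
      finally show "(r + e) *\<^sub>R b
        \<in> (\<lambda>a. e *\<^sub>R a) ` (\<lambda>b. (r + 1) *\<^sub>R b) ` B + (\<lambda>b. (1 - e) *\<^sub>R b) ` (\<lambda>b. r *\<^sub>R b) ` B" .
    qed
  qed (use B e in \<open>auto intro: bounded_sets_scaleR\<close>)
  moreover have "0 \<le> e * \<mu> ((\<lambda>b. r *\<^sub>R b) ` B)"
    using e mnc_nonneg[OF bounded_sets_scaleR[OF B]] by simp
  ultimately show ?thesis by (simp add: algebra_simps)
qed

lemma mnc_plus_compact:
  assumes B: "B \<in> bounded_sets" and C: "compact C" "C \<noteq> {}"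
  shows "\<mu> (B + C) \<le> \<mu> B"
proof (rule le_of_small_multiples)
  fix e :: real assume e: "0 < e" "e < 1"
  \<comment> \<open>This choice makes division by \<open>l\<close> the dilation by
    \<open>1 + e\<close>, which \<open>mnc_scale_interpolate\<close> controls.\<close>
  define l where "l = 1 / (1 + e)"
  have l: "0 < l" "l < 1" "l * (1 + e) = 1" using e by (auto simp: l_def)
  let ?B = "(\<lambda>b. (1 + e) *\<^sub>R b) ` B" and ?C = "(\<lambda>c. (1 / (1 - l)) *\<^sub>R c) ` C"
  have C': "compact ?C" "?C \<noteq> {}" using C by (auto intro: compact_scaling)
  have "(\<lambda>a. l *\<^sub>R a) ` ?B = B" "(\<lambda>c. (1 - l) *\<^sub>R c) ` ?C = C"
    using l by (simp_all add: image_image)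
  then have "\<mu> (B + C) \<le> l * \<mu> ?B + (1 - l) * \<mu> ?C"
    using l by (intro mnc_le_convex_combination bounded_sets_plus B bounded_sets_scaleR[OF B]
        bounded_sets_compact[OF C] bounded_sets_compact[OF C']) auto
  \<comment> \<open>The factor \<open>1 / (1 - l)\<close> is unbounded as \<open>l\<close> tends to
    1, but every dilate of \<open>C\<close> is compact and has measure 0.\<close>
  also have "\<dots> = l * \<mu> ?B" using mnc_compact[OF C'] by simp
  also have "\<dots> \<le> 1 * \<mu> ?B" using l by (intro mult_right_mono mnc_nonneg bounded_sets_scaleR B) auto
  also have "\<dots> \<le> \<mu> B + e * \<mu> ((\<lambda>b. 2 *\<^sub>R b) ` B)"
    using mnc_scale_interpolate[OF B, of e 1] e by simp
  finally show "\<mu> (B + C) \<le> \<mu> B + e * \<mu> ((\<lambda>b. 2 *\<^sub>R b) ` B)" .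
qed

text \<open>The bound on support functions becomes an inclusion in a neighbourhood of a convex hull.
  Adding the convex ball commutes with taking the hull, so the hull can be removed by invariance and
  then \<open>C\<close> by \<open>mnc_plus_compact\<close>.\<close>

lemma mnc_compactly_below:
  assumes A: "A \<in> bounded_sets" and B: "B \<in> bounded_sets"
    and AB: "compactly_below A B d" and "0 \<le> d" "d < \<delta>"
  shows "\<mu> A \<le> \<mu> (B + cball 0 \<delta>)"
proof -
  \<comment> \<open>Half of the gap between \<open>d\<close> and \<delta> is spent on the compact
    domination; the other half keeps strict the inequality that \<open>subset_of_J_le\<close>
    requires.\<close>
  obtain C where C: "compact C" "C \<noteq> {}" "\<And>\<omega>. J A \<omega> \<le> J B \<omega> + J C \<omega> + d + (\<delta> - d) / 2"
    using AB \<open>d < \<delta>\<close> unfolding compactly_below_def by (meson diff_gt_0_iff_gt half_gt_zero)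
  note bsC = bounded_sets_compact[OF C(1,2)]
  note BC = bounded_sets_plus[OF B bsC]
  have ball: "cball 0 \<delta> \<in> (bounded_sets :: 'a set set)" using assms by (intro bounded_sets_cball) simp
  have "A \<subseteq> convex hull (B + C) + cball 0 \<delta>"
  proof (rule subset_of_J_le[OF A bounded_sets_convex_hull[OF BC] convex_convex_hull])
    show "J A \<omega> \<le> J (convex hull (B + C)) \<omega> + (d + \<delta>) / 2" for \<omega>
      using C(3)[of \<omega>] by (simp add: J_convex_hull[OF BC] J_plus[OF B bsC] field_simps)
    show "(d + \<delta>) / 2 < \<delta>" using \<open>d < \<delta>\<close> by simp
  qed
  also have "\<dots> = convex hull ((B + cball 0 \<delta>) + C)"
    by (simp add: convex_hull_set_plus hull_same[of convex "cball 0 \<delta>"] ac_simps)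
  finally have "\<mu> A \<le> \<mu> (convex hull ((B + cball 0 \<delta>) + C))"
    by (intro mnc_mono A bounded_sets_convex_hull bounded_sets_plus B ball bsC)
  also have "\<dots> = \<mu> ((B + cball 0 \<delta>) + C)"
    by (intro mnc_convex_hull bounded_sets_plus B ball bsC)
  also have "\<dots> \<le> \<mu> (B + cball 0 \<delta>)"
    by (intro mnc_plus_compact bounded_sets_plus B ball C)
  finally show ?thesis .
qed

text \<open>A convex measure need not be subadditive. Instead the ball is absorbed through
  \<open>b + \<delta> w = \<delta> (b + w) + (1 - \<delta>) b\<close> with \<open>w\<close> in the
  unit ball.\<close>

lemma mnc_plus_cball:
  assumes B: "B \<in> bounded_sets" and \<delta>: "0 \<le> \<delta>" "\<delta> \<le> 1"
  shows "\<mu> (B + cball 0 \<delta>) \<le> \<mu> B + \<delta> * \<mu> (B + cball 0 1)"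
proof -
  have "\<mu> (B + cball 0 \<delta>) \<le> \<delta> * \<mu> (B + cball 0 1) + (1 - \<delta>) * \<mu> B"
  proof (rule mnc_le_convex_combination)
    show "B + cball 0 \<delta> \<subseteq> (\<lambda>a. \<delta> *\<^sub>R a) ` (B + cball 0 1) + (\<lambda>b. (1 - \<delta>) *\<^sub>R b) ` B"
    proof
      fix x assume "x \<in> B + cball 0 \<delta>"
      then obtain b v where x: "x = b + v" "b \<in> B" "v \<in> cball 0 \<delta>" by (elim set_plus_elim)
      then obtain w where w: "w \<in> cball 0 1" "v = \<delta> *\<^sub>R w"
        unfolding scaleR_cball_0[OF \<delta>(1), symmetric] by auto
      have "\<delta> *\<^sub>R (b + w) + (1 - \<delta>) *\<^sub>R b \<in> (\<lambda>a. \<delta> *\<^sub>R a) ` (B + cball 0 1) + (\<lambda>b. (1 - \<delta>) *\<^sub>R b) ` B"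
        using x w by (intro set_plus_intro imageI)
      also have "\<delta> *\<^sub>R (b + w) + (1 - \<delta>) *\<^sub>R b = x"
        using x w by (simp add: algebra_simps)
      finally show "x \<in> (\<lambda>a. \<delta> *\<^sub>R a) ` (B + cball 0 1) + (\<lambda>b. (1 - \<delta>) *\<^sub>R b) ` B" .
    qed
  qed (use B \<delta> in \<open>auto intro!: bounded_sets_plus bounded_sets_cball\<close>)
  moreover have "0 \<le> \<delta> * \<mu> B" using \<delta> mnc_nonneg[OF B] by simp
  ultimately show ?thesis by (simp add: algebra_simps)
qed

lemma mnc_mono_compactly_below:
  assumes A: "A \<in> bounded_sets" and B: "B \<in> bounded_sets" and AB: "compactly_below A B 0"
  shows "\<mu> A \<le> \<mu> B"
proof (rule le_of_small_multiples)
  fix e :: real assume e: "0 < e" "e < 1"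
  have "\<mu> A \<le> \<mu> (B + cball 0 e)" by (rule mnc_compactly_below[OF A B AB]) (use e in auto)
  also have "\<dots> \<le> \<mu> B + e * \<mu> (B + cball 0 1)" by (rule mnc_plus_cball[OF B]) (use e in auto)
  finally show "\<mu> A \<le> \<mu> B + e * \<mu> (B + cball 0 1)" .
qed

text \<open>Comparison with the singleton of 0 puts the measure below that of a slightly larger
  ball; interpolation along the dilates brings the radius back to \<open>r\<close>.\<close>

lemma mnc_le_cball:
  assumes A: "A \<in> bounded_sets" and Ar: "compactly_below A {0} r" and r: "0 \<le> r"
  shows "\<mu> A \<le> \<mu> (cball 0 r)"
proof (rule le_of_small_multiples)
  fix e :: real assume e: "0 < e" "e < 1"
  have "\<mu> A \<le> \<mu> ({0} + cball 0 (r + e))"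
    by (rule mnc_compactly_below[OF A _ Ar]) (use e r in \<open>auto simp: bounded_sets_def\<close>)
  also have "{0} + cball 0 (r + e) = (cball 0 (r + e) :: 'a set)" by (auto simp: set_plus_def)
  also have "\<mu> (cball 0 (r + e)) \<le> \<mu> (cball 0 r) + e * \<mu> (cball 0 (r + 1))"
    using mnc_scale_interpolate[OF bounded_sets_cball[of 1 0], of e r] e r
    by (simp add: scaleR_cball_0)
  finally show "\<mu> A \<le> \<mu> (cball 0 r) + e * \<mu> (cball 0 (r + 1))" .
qed

lemma mnc_Lipschitz:
  assumes A: "A \<in> bounded_sets" and B: "B \<in> bounded_sets" and r: "0 \<le> r"
    and Ar: "compactly_below A {0} r" and Br: "compactly_below B {0} r"
    and AB: "compactly_below A B d" and d: "0 \<le> d"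
  shows "\<mu> A - \<mu> B \<le> \<mu> (cball 0 (1 + r)) * d"
proof (cases "d < 1")
  case False
  \<comment> \<open>For \<open>d \<ge> 1\<close> the number \<open>d\<close> is no convex weight,
    but the uniform bound on \<open>\<mu> A\<close> already suffices.\<close>
  have "\<mu> A \<le> \<mu> (cball 0 r)" by (rule mnc_le_cball[OF A Ar r])
  also have "\<dots> \<le> \<mu> (cball 0 (1 + r)) * 1"
    using r by (simp add: mnc_mono bounded_sets_cball subset_cball)
  also have "\<dots> \<le> \<mu> (cball 0 (1 + r)) * d"
    using False r by (intro mult_left_mono mnc_nonneg bounded_sets_cball) auto
  finally show ?thesis using mnc_nonneg[OF B] by linarith
next
  case True
  let ?M = "\<mu> (cball 0 (1 + r))"
  have B1: "B + cball 0 1 \<in> bounded_sets" by (intro bounded_sets_plus B bounded_sets_cball) simp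
  \<comment> \<open>Adding the unit ball raises the bound \<open>r\<close> by 1, which is the origin
    of the radius \<open>1 + r\<close> in the Lipschitz constant.\<close>
  have "compactly_below (B + cball 0 1) {0} (1 + r)"
    unfolding compactly_below_def
  proof (intro allI impI)
    fix e :: real assume "0 < e"
    then obtain C where C: "compact C" "C \<noteq> {}" "\<And>\<omega>. J B \<omega> \<le> J {0} \<omega> + J C \<omega> + r + e"
      using Br unfolding compactly_below_def by blast
    have "J (cball 0 1) \<omega> \<le> 1" for \<omega> :: "'a dual_ball"
    proof (rule J_least)
      show "blinfun_apply (functional \<omega>) b \<le> 1" if "b \<in> cball 0 1" for b
        using abs_functional_le[of \<omega> b] that by simp
    qed (rule bounded_sets_cball, simp)
    moreover have "J (B + cball 0 1) = J B + J (cball 0 1)"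
      by (intro J_plus B bounded_sets_cball) simp
    ultimately have "J (B + cball 0 1) \<omega> \<le> J {0} \<omega> + J C \<omega> + (1 + r) + e" for \<omega>
      using C(3)[of \<omega>] by (simp add: algebra_simps) (smt (verit))
    then show "\<exists>C. compact C \<and> C \<noteq> {} \<and> (\<forall>\<omega>. J (B + cball 0 1) \<omega> \<le> J {0} \<omega> + J C \<omega> + (1 + r) + e)"
      using C by blast
  qed
  then have M: "\<mu> (B + cball 0 1) \<le> ?M"
    using r by (intro mnc_le_cball B1) auto
  have "\<mu> A \<le> \<mu> B + ?M * d"
  proof (rule le_of_small_multiples)
    fix e :: real assume e: "0 < e" "e < 1"
    \<comment> \<open>A point between \<open>d\<close> and 1 that tends to \<open>d\<close> with
      \<open>e\<close>: above \<open>d\<close> for \<open>mnc_compactly_below\<close>, at most 1 for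
      \<open>mnc_plus_cball\<close>.\<close>
    let ?\<delta> = "d + e * (1 - d)"
    have \<delta>: "d < ?\<delta>" "?\<delta> \<le> 1"
      using True e mult_right_mono[of e 1 "1 - d"] by (auto simp: algebra_simps)
    have "\<mu> A \<le> \<mu> (B + cball 0 ?\<delta>)" by (rule mnc_compactly_below[OF A B AB d \<delta>(1)])
    also have "\<dots> \<le> \<mu> B + ?\<delta> * \<mu> (B + cball 0 1)"
      using \<delta> d by (intro mnc_plus_cball B) auto
    also have "\<dots> \<le> \<mu> B + ?\<delta> * ?M"
      using \<delta> d M by (intro add_left_mono mult_left_mono) auto
    finally show "\<mu> A \<le> \<mu> B + ?M * d + e * ((1 - d) * ?M)" by (simp add: algebra_simps)
  qed
  then show ?thesis by simp
qed

text \<open>Subadditivity and homogeneity split off the ball directly, so the constant does not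
  depend on a radius and \<open>d\<close> need not be less than 1.\<close>

lemma sublinear_mnc_Lipschitz:
  assumes sub: "sublinear_mnc \<mu>" and A: "A \<in> bounded_sets" and B: "B \<in> bounded_sets"
    and AB: "compactly_below A B d" and d: "0 \<le> d"
  shows "\<mu> A - \<mu> B \<le> \<mu> (cball 0 1) * d"
proof -
  have "\<mu> A \<le> \<mu> B + \<mu> (cball 0 1) * d"
  proof (rule le_of_small_multiples)
    fix e :: real assume e: "0 < e" "e < 1"
    have "\<mu> (B + cball 0 (d + e)) \<le> \<mu> B + \<mu> (cball 0 (d + e))"
      using sub B bounded_sets_cball[of "d + e" "0::'a"] d e unfolding sublinear_mnc_def sum_set_eq by simp
    moreover have "\<mu> ((\<lambda>b. (d + e) *\<^sub>R b) ` cball 0 1) = (d + e) * \<mu> (cball 0 1)"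
      using sub bounded_sets_cball[of 1 "0::'a"] d e unfolding sublinear_mnc_def by simp
    then have "\<mu> (cball 0 (d + e)) = (d + e) * \<mu> (cball 0 1)"
      using d e by (simp add: scaleR_cball_0)
    moreover have "\<mu> A \<le> \<mu> (B + cball 0 (d + e))"
      using e by (intro mnc_compactly_below[OF A B AB d]) simp
    ultimately show "\<mu> A \<le> \<mu> B + \<mu> (cball 0 1) * d + e * \<mu> (cball 0 1)"
      by (simp add: algebra_simps)
  qed
  then show ?thesis by simp
qed

end

section \<open>Representation\<close>

lemma coset_norm_lessE:
  assumes "0 \<in> N" "coset_norm (Q N f) < d"
  obtains n where "n \<in> N" "norm (f + n) < d"
proof -
  have "norm ` Q N f \<noteq> {}" using assms(1) by (auto simp: Q_def)
  then obtain x where "x \<in> norm ` Q N f" "x < d"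
    using cInf_lessD[of "norm ` Q N f" d] assms(2) unfolding coset_norm_def by auto
  then show ?thesis using that by (auto simp: Q_def)
qed

lemma coset_norm_le:
  assumes "n \<in> N"
  shows "coset_norm (Q N f) \<le> norm (f + n)"
  unfolding coset_norm_def
  by (rule cInf_lower) (use assms in \<open>auto simp: Q_def intro!: bdd_belowI[of _ 0]\<close>)

lemma coset_norm_nonneg: "0 \<in> N \<Longrightarrow> 0 \<le> coset_norm (Q N f)"
  unfolding coset_norm_def by (rule cInf_greatest) (auto simp: Q_def)

section \<open>Factorization through \<open>K\<close> for a quotient by a set between
  \<open>E_K\<close> and \<open>compactly_dominated\<close>\<close>

context
  fixes N :: "'a::real_normed_vector cb_dual set" and K :: "'k topology" and T
  assumes N: "E_K \<subseteq> N" "N \<subseteq> compactly_dominated"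
    and iso: "linear_order_isometry_onto_sublattice N K T"
begin

lemma zero_in_N: "0 \<in> N"
  using N(1) J_singleton_in_E_K[of 0] by (auto simp: J_zero)

lemma T_in_C_space: "f \<in> E_C \<Longrightarrow> T (Q N f) \<in> C_space K"
  using iso by (simp add: linear_order_isometry_onto_sublattice_def)

lemma T_add: "f \<in> E_C \<Longrightarrow> g \<in> E_C \<Longrightarrow> T (Q N (f + g)) = (\<lambda>k. T (Q N f) k + T (Q N g) k)"
  using iso by (simp add: linear_order_isometry_onto_sublattice_def)

lemma T_scaleR: "f \<in> E_C \<Longrightarrow> T (Q N (c *\<^sub>R f)) = (\<lambda>k. c * T (Q N f) k)"
  using iso by (simp add: linear_order_isometry_onto_sublattice_def)

lemma T_norm: "f \<in> E_C \<Longrightarrow> C_norm K (T (Q N f)) = coset_norm (Q N f)"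
  using iso by (simp add: linear_order_isometry_onto_sublattice_def)

lemma T_le: "f \<in> E_C \<Longrightarrow> g \<in> E_C \<Longrightarrow> C_le K (T (Q N f)) (T (Q N g)) \<longleftrightarrow> coset_le (Q N f) (Q N g)"
  using iso by (simp add: linear_order_isometry_onto_sublattice_def)

lemma T_diff:
  assumes "f \<in> E_C" "g \<in> E_C"
  shows "T (Q N (f - g)) = (\<lambda>k. T (Q N f) k - T (Q N g) k)"
  using T_add[OF assms(1) subspace_scale[OF subspace_E_C assms(2), of "- 1"]] T_scaleR[OF assms(2), of "- 1"]
  by simp

lemma TQJ_convex_combination:
  assumes "A \<in> bounded_sets" "B \<in> bounded_sets" "0 \<le> t" "t \<le> 1"
  shows "TQJ N T ((\<lambda>a. t *\<^sub>R a) ` A + (\<lambda>b. (1 - t) *\<^sub>R b) ` B)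
    = (\<lambda>k. t * TQJ N T A k + (1 - t) * TQJ N T B k)"
proof -
  have "J ((\<lambda>a. t *\<^sub>R a) ` A + (\<lambda>b. (1 - t) *\<^sub>R b) ` B) = t *\<^sub>R J A + (1 - t) *\<^sub>R J B"
    using assms by (simp add: J_plus J_scaleR bounded_sets_scaleR)
  then show ?thesis
    using assms by (simp add: TQJ_def T_add T_scaleR J_in_E_C subspace_scale[OF subspace_E_C])
qed

lemma TQJ_cball:
  assumes "0 \<le> c"
  shows "TQJ N T (cball 0 c) = (\<lambda>k. c * TQJ N T (cball 0 1) k)"
  using J_scaleR[OF bounded_sets_cball assms, of 1 "0::'a"] assms
  by (simp add: TQJ_def scaleR_cball_0 T_scaleR J_in_E_C bounded_sets_cball)

text \<open>For any point \<open>b\<close> of \<open>B\<close>, the function \<open>J {b}\<close>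
  lies in \<open>E_K\<close>, hence represents the zero class, and it is below
  \<open>J B\<close>.\<close>

lemma TQJ_nonneg:
  assumes B: "B \<in> bounded_sets"
  shows "TQJ N T B \<in> C_pos K"
proof -
  obtain b where b: "b \<in> B" using B by (auto simp: bounded_sets_def)
  have zero: "(0::'a cb_dual) \<in> E_C" by (rule subspace_0[OF subspace_E_C])
  have "coset_le (Q N 0) (Q N (J B))"
    unfolding coset_le_def
  proof (intro bexI)
    show "\<forall>\<omega>. J {b} \<omega> \<le> J B \<omega>" using J_upper[OF B b] by (simp add: J_singleton)
    show "J {b} \<in> Q N 0" using J_singleton_in_E_K[of b] N(1) by (auto simp: Q_def)
    show "J B \<in> Q N (J B)" using zero_in_N by (auto simp: Q_def image_iff intro!: bexI[of _ 0])
  qed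
  then have "C_le K (T (Q N 0)) (T (Q N (J B)))"
    using T_le[OF zero J_in_E_C[OF B]] by simp
  moreover have "T (Q N 0) = (\<lambda>k. 0)" using T_scaleR[OF zero, of 0] by simp
  ultimately show ?thesis
    using T_in_C_space[OF J_in_E_C[OF B]] by (simp add: C_pos_def TQJ_def)
qed

lemma compactly_below_of_TQJ_le:
  assumes A: "A \<in> bounded_sets" and B: "B \<in> bounded_sets" and le: "C_le K (TQJ N T A) (TQJ N T B)"
  shows "compactly_below A B 0"
proof (rule compactly_belowI)
  fix e :: real assume e: "0 < e"
  have "coset_le (Q N (J A)) (Q N (J B))"
    using le T_le[OF J_in_E_C[OF A] J_in_E_C[OF B]] by (simp add: TQJ_def)
  then obtain n m where nm: "n \<in> N" "m \<in> N" "\<And>\<omega>. J A \<omega> + n \<omega> \<le> J B \<omega> + m \<omega>"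
    by (auto simp: coset_le_def Q_def)
  have "m - n \<in> compactly_dominated"
    using nm N(2) by (intro subspace_diff[OF subspace_compactly_dominated]) auto
  moreover have "J A \<omega> \<le> J B \<omega> + (m - n) \<omega> + 0 + e" for \<omega>
    using nm(3)[of \<omega>] e by simp
  ultimately show "\<exists>f\<in>compactly_dominated. \<forall>\<omega>. J A \<omega> \<le> J B \<omega> + f \<omega> + 0 + e" by blast
qed

text \<open>The coset norm is an infimum that may not be attained; the tolerance in
  \<open>compactly_below\<close> absorbs the error of a nearly optimal representative.\<close>

lemma compactly_below_of_coset_norm:
  assumes A: "A \<in> bounded_sets" and B: "B \<in> bounded_sets" and le: "coset_norm (Q N (J A - J B)) \<le> d"
  shows "compactly_below A B d"
proof (rule compactly_belowI)
  fix e :: real assume e: "0 < e"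
  then have "coset_norm (Q N (J A - J B)) < d + e" using le by simp
  then obtain n where n: "n \<in> N" "norm (J A - J B + n) < d + e"
    by (rule coset_norm_lessE[OF zero_in_N])
  have "- n \<in> compactly_dominated"
    using n N(2) by (intro subspace_neg[OF subspace_compactly_dominated]) auto
  moreover have "J A \<omega> \<le> J B \<omega> + (- n) \<omega> + d + e" for \<omega>
    using norm_bounded[of "J A - J B + n" \<omega>] n(2) by simp
  ultimately show "\<exists>f\<in>compactly_dominated. \<forall>\<omega>. J A \<omega> \<le> J B \<omega> + f \<omega> + d + e" by blast
qed

lemma C_norm_TQJ_diff:
  assumes "A \<in> bounded_sets" "B \<in> bounded_sets"
  shows "C_norm K (\<lambda>k. TQJ N T A k - TQJ N T B k) = coset_norm (Q N (J A - J B))"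
  using T_norm[OF J_diff_in_E_C[OF assms]] T_diff[OF J_in_E_C J_in_E_C, OF assms]
  by (simp add: TQJ_def)

lemma compactly_below_of_C_norm:
  assumes "B \<in> bounded_sets" "C_norm K (TQJ N T B) \<le> r"
  shows "compactly_below B {0} r"
  using assms T_norm[OF J_in_E_C[OF assms(1)]]
  by (intro compactly_below_of_coset_norm) (auto simp: bounded_sets_def TQJ_def J_zero)

lemma ex_represents_mnc:
  assumes mnc: "convex_mnc \<mu>"
  shows "\<exists>F. represents_mnc K (TQJ N T) \<mu> F"
proof -
  \<comment> \<open>\<open>F\<close> evaluates \<mu> on an arbitrary preimage. Independence of the
    choice is \<open>mono\<close> applied in both directions; off the image of
    \<open>bounded_sets\<close> the value is arbitrary.\<close>
  define F where "F f = \<mu> (SOME B. B \<in> bounded_sets \<and> TQJ N T B = f)" for f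
  have mono: "\<mu> A \<le> \<mu> B" if "A \<in> bounded_sets" "B \<in> bounded_sets" "C_le K (TQJ N T A) (TQJ N T B)" for A B
    using that by (intro mnc_mono_compactly_below[OF mnc] compactly_below_of_TQJ_le)
  have F: "F (TQJ N T B) = \<mu> B" if B: "B \<in> bounded_sets" for B
  proof -
    let ?B = "SOME B'. B' \<in> bounded_sets \<and> TQJ N T B' = TQJ N T B"
    have "?B \<in> bounded_sets \<and> TQJ N T ?B = TQJ N T B"
      by (rule someI[of _ B]) (use B in simp)
    then show ?thesis
      unfolding F_def using B by (intro antisym mono) (auto simp: C_le_def)
  qed
  have F_cball: "F (\<lambda>k. c * TQJ N T (cball 0 1) k) = \<mu> (cball 0 c)" if "0 \<le> c" for c
    using F[OF bounded_sets_cball[OF that, of 0]] by (simp add: TQJ_cball[OF that])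
  have bound: "\<bar>\<mu> A\<bar> \<le> \<mu> (cball 0 r)"
    if "0 \<le> r" "A \<in> bounded_sets" "C_norm K (TQJ N T A) \<le> r" for A r
    using mnc_nonneg[OF mnc] mnc_le_cball[OF mnc] compactly_below_of_C_norm that by simp
  have diff: "compactly_below A B (C_norm K (\<lambda>k. TQJ N T A k - TQJ N T B k))"
    "compactly_below B A (C_norm K (\<lambda>k. TQJ N T A k - TQJ N T B k))"
    "0 \<le> C_norm K (\<lambda>k. TQJ N T A k - TQJ N T B k)"
    if AB: "A \<in> bounded_sets" "B \<in> bounded_sets" for A B
  proof -
    have "C_norm K (\<lambda>k. TQJ N T A k - TQJ N T B k) = C_norm K (\<lambda>k. TQJ N T B k - TQJ N T A k)"
      by (simp add: C_norm_def abs_minus_commute)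
    then show "compactly_below A B (C_norm K (\<lambda>k. TQJ N T A k - TQJ N T B k))"
      "compactly_below B A (C_norm K (\<lambda>k. TQJ N T A k - TQJ N T B k))"
      "0 \<le> C_norm K (\<lambda>k. TQJ N T A k - TQJ N T B k)"
      using C_norm_TQJ_diff[OF AB] C_norm_TQJ_diff[OF AB(2,1)] AB coset_norm_nonneg[OF zero_in_N]
      by (auto intro: compactly_below_of_coset_norm)
  qed
  have Lipschitz: "\<bar>\<mu> A - \<mu> B\<bar> \<le> \<mu> (cball 0 (1 + r)) * C_norm K (\<lambda>k. TQJ N T A k - TQJ N T B k)"
    if "0 \<le> r" "A \<in> bounded_sets" "B \<in> bounded_sets" "C_norm K (TQJ N T A) \<le> r" "C_norm K (TQJ N T B) \<le> r" for A B r
    using that mnc_Lipschitz[OF mnc that(2,3,1)] mnc_Lipschitz[OF mnc that(3,2,1)]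
      diff[OF that(2,3)] compactly_below_of_C_norm by (intro abs_leI) auto
  have sublinear: "\<bar>\<mu> A - \<mu> B\<bar> \<le> \<mu> (cball 0 1) * C_norm K (\<lambda>k. TQJ N T A k - TQJ N T B k)"
    if "sublinear_mnc \<mu>" "A \<in> bounded_sets" "B \<in> bounded_sets" for A B
    using sublinear_mnc_Lipschitz[OF mnc that] sublinear_mnc_Lipschitz[OF mnc that(1,3,2)]
      diff[OF that(2,3)] by (intro abs_leI) auto
  have convex: "(\<lambda>k. t * TQJ N T A k + (1 - t) * TQJ N T B k) \<in> TQJ N T ` bounded_sets"
    "F (\<lambda>k. t * TQJ N T A k + (1 - t) * TQJ N T B k) \<le> t * \<mu> A + (1 - t) * \<mu> B"
    if AB: "A \<in> bounded_sets" "B \<in> bounded_sets" and t: "0 \<le> t" "t \<le> 1" for A B t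
  proof -
    let ?S = "(\<lambda>a. t *\<^sub>R a) ` A + (\<lambda>b. (1 - t) *\<^sub>R b) ` B"
    have S: "?S \<in> bounded_sets" by (intro bounded_sets_plus bounded_sets_scaleR AB)
    note eq = TQJ_convex_combination[OF AB t]
    show "(\<lambda>k. t * TQJ N T A k + (1 - t) * TQJ N T B k) \<in> TQJ N T ` bounded_sets"
      unfolding eq[symmetric] using S by (rule imageI)
    show "F (\<lambda>k. t * TQJ N T A k + (1 - t) * TQJ N T B k) \<le> t * \<mu> A + (1 - t) * \<mu> B"
      unfolding eq[symmetric] F[OF S] by (rule mnc_le_convex_combination[OF mnc S AB t order_refl])
  qed
  have "represents_mnc K (TQJ N T) \<mu> F"
    unfolding represents_mnc_def Let_def
    using TQJ_nonneg F F_cball mnc_nonneg[OF mnc] convex mono bound Lipschitz sublinear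
    by (auto simp: scaleR_cball_0)
  then show ?thesis by (rule exI[of _ F])
qed

end

section \<open>Lattice homomorphisms\<close>

definition cb_abs :: "('b::topological_space \<Rightarrow>\<^sub>C real) \<Rightarrow> 'b \<Rightarrow>\<^sub>C real"
  where "cb_abs f = Bcontfun (\<lambda>x. \<bar>apply_bcontfun f x\<bar>)"

text \<open>Expressed by linear operations and the absolute value, so that whatever respects those
  also respects maxima, and likewise minima.\<close>

definition cb_max :: "('b::topological_space \<Rightarrow>\<^sub>C real) \<Rightarrow> ('b \<Rightarrow>\<^sub>C real) \<Rightarrow> 'b \<Rightarrow>\<^sub>C real"
  where "cb_max f g = (1 / 2) *\<^sub>R (f + g + cb_abs (f - g))"

definition cb_min :: "('b::topological_space \<Rightarrow>\<^sub>C real) \<Rightarrow> ('b \<Rightarrow>\<^sub>C real) \<Rightarrow> 'b \<Rightarrow>\<^sub>C real"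
  where "cb_min f g = (1 / 2) *\<^sub>R (f + g - cb_abs (f - g))"

lemma apply_cb_abs [simp]: "apply_bcontfun (cb_abs f) x = \<bar>apply_bcontfun f x\<bar>"
proof -
  have "(\<lambda>x. \<bar>apply_bcontfun f x\<bar>) \<in> bcontfun"
    using norm_bounded[of f] by (intro bcontfun_normI[of _ "norm f"] continuous_intros) auto
  then show ?thesis by (simp add: cb_abs_def Bcontfun_inverse)
qed

lemma apply_cb_max [simp]: "apply_bcontfun (cb_max f g) x = max (f x) (g x)"
  by (simp add: cb_max_def max_def)

lemma apply_cb_min [simp]: "apply_bcontfun (cb_min f g) x = min (f x) (g x)"
  by (simp add: cb_min_def min_def)

lemma continuous_on_cb_abs:
  fixes S :: "('b::topological_space \<Rightarrow>\<^sub>C real) set"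
  shows "continuous_on S cb_abs"
proof -
  have "1-lipschitz_on S (cb_abs :: ('b \<Rightarrow>\<^sub>C real) \<Rightarrow> _)"
  proof (rule lipschitz_onI)
    fix f g :: "'b \<Rightarrow>\<^sub>C real"
    show "dist (cb_abs f) (cb_abs g) \<le> 1 * dist f g"
    proof (rule dist_bound)
      fix x
      have "dist (cb_abs f x) (cb_abs g x) \<le> dist (f x) (g x)"
        by (simp add: dist_real_def abs_triangle_ineq3)
      also have "\<dots> \<le> dist f g" by (rule dist_bounded)
      finally show "dist (cb_abs f x) (cb_abs g x) \<le> 1 * dist f g" by simp
    qed
  qed simp
  then show ?thesis by (rule lipschitz_on_continuous_on)
qed

text \<open>The absolute value of a difference is twice the maximum minus the sum, and the maximum
  of two support functions is the support function of the union. Continuity of \<open>cb_abs\<close>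
  extends this to the closure.\<close>

lemma cb_abs_in_E_C:
  assumes "f \<in> E_C"
  shows "cb_abs f \<in> E_C"
proof -
  let ?D = "{J A - J B | A B :: 'a set. A \<in> bounded_sets \<and> B \<in> bounded_sets}"
  have "cb_abs ` closure ?D \<subseteq> E_C"
  proof (rule image_closure_subset[OF continuous_on_cb_abs closed_E_C], safe)
    fix A B :: "'a set" assume AB: "A \<in> bounded_sets" "B \<in> bounded_sets"
    have "cb_abs (J A - J B) = 2 *\<^sub>R J (A \<union> B) - (J A + J B)"
      by (rule bcontfun_eqI) (simp add: J_Un[OF AB] max_def)
    then show "cb_abs (J A - J B) \<in> E_C"
      using AB by (auto intro!: subspace_diff[OF subspace_E_C] subspace_scale[OF subspace_E_C]
          subspace_add[OF subspace_E_C] J_in_E_C bounded_sets_Un)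
  qed
  then show ?thesis using assms unfolding E_C_eq by blast
qed

lemma cb_max_in_E_C: "f \<in> E_C \<Longrightarrow> g \<in> E_C \<Longrightarrow> cb_max f g \<in> E_C"
  unfolding cb_max_def
  by (intro subspace_diff[OF subspace_E_C] subspace_scale[OF subspace_E_C]
      subspace_add[OF subspace_E_C] cb_abs_in_E_C)

lemma cb_min_in_E_C: "f \<in> E_C \<Longrightarrow> g \<in> E_C \<Longrightarrow> cb_min f g \<in> E_C"
  unfolding cb_min_def
  by (intro subspace_diff[OF subspace_E_C] subspace_scale[OF subspace_E_C]
      subspace_add[OF subspace_E_C] cb_abs_in_E_C)

text \<open>The functionals live on the whole function space, so point evaluations belong to the
  case of empty \<open>N\<close>. The norm is bounded by 1 rather than equal to 1, a closed
  condition under pointwise convergence.\<close>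

definition lattice_characters :: "('b::topological_space \<Rightarrow>\<^sub>C real) set \<Rightarrow> (('b \<Rightarrow>\<^sub>C real) \<Rightarrow> real) set"
  where "lattice_characters N = {\<phi>. (\<forall>f g. \<phi> (f + g) = \<phi> f + \<phi> g) \<and> (\<forall>c f. \<phi> (c *\<^sub>R f) = c * \<phi> f) \<and>
    (\<forall>f. \<phi> (cb_abs f) = \<bar>\<phi> f\<bar>) \<and> (\<forall>f. \<bar>\<phi> f\<bar> \<le> norm f) \<and> (\<forall>n\<in>N. \<phi> n = 0)}"

lemma evaluation_lattice_character:
  fixes x :: "'b::topological_space"
  shows "(\<lambda>f. apply_bcontfun f x) \<in> lattice_characters {}"
proof -
  have "\<bar>apply_bcontfun f x\<bar> \<le> norm f" for f :: "'b \<Rightarrow>\<^sub>C real"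
    using norm_bounded[of f x] by simp
  then show ?thesis by (simp add: lattice_characters_def)
qed

text \<open>As in the Banach-Alaoglu theorem: the defining conditions are closed for pointwise
  convergence, and the norm bound places the set in a product of compact intervals.\<close>

lemma compact_lattice_characters: "compact (lattice_characters N)"
proof -
  have "closed (lattice_characters N)"
    unfolding lattice_characters_def Ball_def
    by (intro closed_Collect_conj closed_Collect_all closed_Collect_imp open_Collect_const closed_Collect_eq closed_Collect_le
        continuous_intros continuous_on_product_coordinates)
  moreover have "compact (PiE UNIV (\<lambda>f :: 'a \<Rightarrow>\<^sub>C real. {- norm f..norm f}))"
  proof -
    have "compactin (product_topology (\<lambda>f. euclideanreal) UNIV) (PiE UNIV (\<lambda>f :: 'a \<Rightarrow>\<^sub>C real. {- norm f..norm f}))"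
      by (simp add: compactin_PiE)
    then show ?thesis by (simp add: euclidean_product_topology)
  qed
  moreover have "lattice_characters N \<subseteq> PiE UNIV (\<lambda>f. {- norm f..norm f})"
    by (auto simp: lattice_characters_def abs_le_iff minus_le_iff)
  ultimately show ?thesis
    by (metis compact_Int_closed inf.absorb_iff2)
qed

context
  fixes \<phi> :: "('b::topological_space \<Rightarrow>\<^sub>C real) \<Rightarrow> real" and N
  assumes \<phi>: "\<phi> \<in> lattice_characters N"
begin

lemma character_add: "\<phi> (f + g) = \<phi> f + \<phi> g"
  using \<phi> by (simp add: lattice_characters_def)

lemma character_scaleR: "\<phi> (c *\<^sub>R f) = c * \<phi> f"
  using \<phi> by (simp add: lattice_characters_def)

lemma character_abs: "\<phi> (cb_abs f) = \<bar>\<phi> f\<bar>"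
  using \<phi> by (simp add: lattice_characters_def)

lemma character_le_norm: "\<bar>\<phi> f\<bar> \<le> norm f"
  using \<phi> by (simp add: lattice_characters_def)

lemma character_zero_on: "n \<in> N \<Longrightarrow> \<phi> n = 0"
  using \<phi> by (simp add: lattice_characters_def)

lemma character_diff: "\<phi> (f - g) = \<phi> f - \<phi> g"
  using character_add[of f "(- 1) *\<^sub>R g"] character_scaleR[of "- 1" g] by simp

lemma character_max: "\<phi> (cb_max f g) = max (\<phi> f) (\<phi> g)"
  by (simp add: cb_max_def character_scaleR character_add character_abs character_diff max_def)

lemma character_min: "\<phi> (cb_min f g) = min (\<phi> f) (\<phi> g)"
  by (simp add: cb_min_def character_scaleR character_add character_abs character_diff min_def)

lemma character_mono:
  assumes "\<And>x. apply_bcontfun f x \<le> apply_bcontfun g x"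
  shows "\<phi> f \<le> \<phi> g"
proof -
  have "cb_max f g = g" by (rule bcontfun_eqI) (simp add: assms max_absorb2)
  then show ?thesis using character_max[of f g] by simp
qed

end

section \<open>The quotient norm is attained approximately by characters\<close>

lemma closed_lattice_idealD:
  assumes "closed_lattice_ideal N"
  shows "N \<subseteq> E_C" "closed N" "subspace N"
    "\<And>f g. f \<in> E_C \<Longrightarrow> g \<in> N \<Longrightarrow> (\<And>\<omega>. \<bar>apply_bcontfun f \<omega>\<bar> \<le> \<bar>apply_bcontfun g \<omega>\<bar>) \<Longrightarrow> f \<in> N"
  using assms unfolding closed_lattice_ideal_def by blast+

text \<open>If no such point existed, \<bar>f\<bar> would be at most \<open>s + g\<close> for some
  nonnegative \<open>g\<close> in \<open>N\<close>. Truncating \<open>f\<close> between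
  \<open>- g\<close> and \<open>g\<close> then gives an element of \<open>N\<close> within
  \<open>s\<close> of \<open>f\<close>, against the coset norm.\<close>

lemma ex_dual_ball_almost_annihilating:
  assumes N: "closed_lattice_ideal N" and f: "f \<in> E_C" and s: "0 \<le> s" "s < coset_norm (Q N f)"
    and M: "finite M" "M \<subseteq> N"
  shows "\<exists>\<omega>. (\<forall>n\<in>M. \<bar>apply_bcontfun n \<omega>\<bar> \<le> 1) \<and> s \<le> \<bar>apply_bcontfun f \<omega>\<bar>"
proof (rule ccontr)
  assume contr: "\<not> ?thesis"
  note N = closed_lattice_idealD[OF N]
  define m where "m = (\<Sum>n\<in>M. cb_abs n)"
  \<comment> \<open>The factor \<open>norm f\<close> makes \<open>g\<close> dominate \<bar>f\<bar>
    wherever some member of \<open>M\<close> exceeds 1 in absolute value.\<close>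
  define g where "g = norm f *\<^sub>R m"
  define h where "h = cb_max (cb_min f g) (- g)"
  have "m \<in> N"
    unfolding m_def
  proof (rule subspace_sum[OF N(3)])
    fix n assume "n \<in> M"
    then show "cb_abs n \<in> N"
      using M(2) N(1) by (intro N(4)[of "cb_abs n" n] cb_abs_in_E_C) auto
  qed
  then have gN: "g \<in> N" unfolding g_def by (rule subspace_scale[OF N(3)])
  have m: "m \<omega> = (\<Sum>n\<in>M. \<bar>apply_bcontfun n \<omega>\<bar>)" for \<omega>
    unfolding m_def using M(1) by (induction M rule: finite_induct) auto
  have g_nonneg: "0 \<le> g \<omega>" for \<omega> by (simp add: g_def m sum_nonneg)
  have f_le: "\<bar>f \<omega>\<bar> \<le> s + g \<omega>" for \<omega>
  proof (cases "\<forall>n\<in>M. \<bar>n \<omega>\<bar> \<le> 1")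
    case True
    then have "\<bar>f \<omega>\<bar> < s" using contr by (meson not_le)
    then show ?thesis using g_nonneg[of \<omega>] by simp
  next
    case False
    then obtain n where n: "n \<in> M" "1 < \<bar>n \<omega>\<bar>" by (auto simp: not_le)
    have "\<bar>n \<omega>\<bar> \<le> m \<omega>"
      unfolding m using M(1) n(1) by (intro member_le_sum) auto
    then have "norm f * 1 \<le> norm f * m \<omega>" using n by (intro mult_left_mono) auto
    then show ?thesis using norm_bounded[of f \<omega>] s by (simp add: g_def)
  qed
  have "h \<in> N"
  proof (rule N(4)[OF _ gN])
    show "h \<in> E_C"
      unfolding h_def using gN N(1) f
      by (intro cb_max_in_E_C cb_min_in_E_C subspace_neg[OF subspace_E_C]) auto
    show "\<bar>h \<omega>\<bar> \<le> \<bar>g \<omega>\<bar>" for \<omega>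
      using g_nonneg[of \<omega>] by (simp add: h_def abs_if min_def max_def)
  qed
  then have "coset_norm (Q N f) \<le> norm (f + - h)"
    by (intro coset_norm_le subspace_neg[OF N(3)])
  also have "\<dots> \<le> s"
  proof (rule norm_bound)
    show "norm ((f + - h) \<omega>) \<le> s" for \<omega>
      using g_nonneg[of \<omega>] f_le[of \<omega>] s by (auto simp: h_def min_def max_def abs_if split: if_splits)
  qed
  finally show False using s by simp
qed

text \<open>The evaluations from \<open>ex_dual_ball_almost_annihilating\<close> witness the finite
  intersection property in a compact set. A linear functional bounded by 1 on the subspace
  \<open>N\<close> vanishes there.\<close>

lemma ex_character_ge:
  assumes N: "closed_lattice_ideal N" and f: "f \<in> E_C" and s: "0 \<le> s" "s < coset_norm (Q N f)"
  obtains \<phi> where "\<phi> \<in> lattice_characters N" "s \<le> \<bar>\<phi> f\<bar>"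
proof -
  let ?G = "\<lambda>n. {\<phi>. \<bar>\<phi> n\<bar> \<le> 1 \<and> s \<le> \<bar>\<phi> f\<bar>}"
  have sub: "subspace N" by (rule closed_lattice_idealD(3)[OF N])
  have "lattice_characters {} \<inter> (\<Inter>n\<in>N. ?G n) \<noteq> {}"
  proof (rule compact_imp_fip_image[OF compact_lattice_characters])
    show "closed (?G n)" for n
      by (intro closed_Collect_conj closed_Collect_le continuous_intros continuous_on_product_coordinates)
  next
    fix M assume M: "finite M" "M \<subseteq> N"
    obtain \<omega> where "\<forall>n\<in>M. \<bar>apply_bcontfun n \<omega>\<bar> \<le> 1" "s \<le> \<bar>apply_bcontfun f \<omega>\<bar>"
      using ex_dual_ball_almost_annihilating[OF assms M] by blast
    then have "(\<lambda>f. apply_bcontfun f \<omega>) \<in> lattice_characters {} \<inter> (\<Inter>n\<in>M. ?G n)"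
      using evaluation_lattice_character by auto
    then show "lattice_characters {} \<inter> (\<Inter>n\<in>M. ?G n) \<noteq> {}" by blast
  qed
  then obtain \<phi> where \<phi>: "\<phi> \<in> lattice_characters {}" "\<And>n. n \<in> N \<Longrightarrow> \<bar>\<phi> n\<bar> \<le> 1 \<and> s \<le> \<bar>\<phi> f\<bar>"
    by auto
  have "\<phi> n = 0" if "n \<in> N" for n
  proof (rule ccontr)
    assume "\<phi> n \<noteq> 0"
    then have "\<bar>\<phi> ((2 / \<phi> n) *\<^sub>R n)\<bar> = 2" by (simp add: character_scaleR[OF \<phi>(1)])
    then show False using \<phi>(2)[OF subspace_scale[OF sub that, of "2 / \<phi> n"]] by simp
  qed
  then have "\<phi> \<in> lattice_characters N" using \<phi>(1) by (simp add: lattice_characters_def)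
  then show ?thesis using that \<phi>(2)[OF subspace_0[OF sub]] by blast
qed

text \<open>The choice of representative does not matter when it exists, because characters vanish
  on \<open>N\<close>; the value 0 off the characters follows the convention of
  \<open>C_space\<close>.\<close>

definition character_transform ::
  "('b::topological_space \<Rightarrow>\<^sub>C real) set \<Rightarrow> ('b \<Rightarrow>\<^sub>C real) set \<Rightarrow> (('b \<Rightarrow>\<^sub>C real) \<Rightarrow> real) \<Rightarrow> real"
  where "character_transform N c \<phi> = (if \<phi> \<in> lattice_characters N then \<phi> (SOME f. f \<in> c) else 0)"

lemma character_transform_Q:
  assumes "0 \<in> N"
  shows "character_transform N (Q N f) = (\<lambda>\<phi>. if \<phi> \<in> lattice_characters N then \<phi> f else 0)"
proof
  fix \<phi>
  have "f \<in> Q N f" using assms by (auto simp: Q_def image_iff intro!: bexI[of _ 0])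
  then have "(SOME g. g \<in> Q N f) \<in> Q N f" by (rule someI)
  then obtain n where "n \<in> N" "(SOME g. g \<in> Q N f) = f + n" by (auto simp: Q_def)
  then show "character_transform N (Q N f) \<phi> = (if \<phi> \<in> lattice_characters N then \<phi> f else 0)"
    by (simp add: character_transform_def character_add character_zero_on)
qed

context
  fixes N :: "'a::real_normed_vector cb_dual set"
  assumes N: "closed_lattice_ideal N"
begin

text \<open>A character is constant on the coset and bounded by the norm of each representative,
  which gives one inequality; \<open>ex_character_ge\<close>, for \<open>s\<close> just below the
  coset norm, gives the other.\<close>

lemma coset_norm_character:
  assumes f: "f \<in> E_C"
  shows "C_norm (top_of_set (lattice_characters N)) (character_transform N (Q N f)) = coset_norm (Q N f)"
proof -
  note N' = closed_lattice_idealD[OF N]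
  note zero = subspace_0[OF N'(3)]
  let ?S = "insert 0 ((\<lambda>\<phi>. \<bar>\<phi> f\<bar>) ` lattice_characters N)"
  have eq: "C_norm (top_of_set (lattice_characters N)) (character_transform N (Q N f)) = Sup ?S"
    by (simp add: C_norm_def character_transform_Q[OF zero] cong: image_cong)
  have bdd: "bdd_above ?S"
    using character_le_norm by (intro bdd_aboveI[of _ "norm f"]) fastforce
  have "Sup ?S \<le> coset_norm (Q N f)"
  proof (rule cSup_least)
    fix x assume "x \<in> ?S"
    then consider "x = 0" | \<phi> where "\<phi> \<in> lattice_characters N" "x = \<bar>\<phi> f\<bar>" by auto
    then show "x \<le> coset_norm (Q N f)"
    proof cases
      case 1
      then show ?thesis using coset_norm_nonneg[OF zero] by simp
    next
      case 2
      show ?thesis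
        unfolding coset_norm_def
      proof (rule cInf_greatest)
        show "norm ` Q N f \<noteq> {}" using zero by (auto simp: Q_def)
        fix y assume "y \<in> norm ` Q N f"
        then obtain n where n: "n \<in> N" "y = norm (f + n)" by (auto simp: Q_def)
        then have "x = \<bar>\<phi> (f + n)\<bar>" using 2 by (simp add: character_add character_zero_on)
        then show "x \<le> y" using character_le_norm[OF 2(1)] n by simp
      qed
    qed
  qed simp
  moreover have "coset_norm (Q N f) \<le> Sup ?S"
  proof (rule ccontr)
    assume "\<not> coset_norm (Q N f) \<le> Sup ?S"
    then obtain s where s: "Sup ?S < s" "s < coset_norm (Q N f)" using dense by (auto simp: not_le)
    have "0 \<le> Sup ?S" by (rule cSup_upper[OF _ bdd]) simp
    then have "0 \<le> s" using s by simp
    then obtain \<phi> where \<phi>: "\<phi> \<in> lattice_characters N" "s \<le> \<bar>\<phi> f\<bar>"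
      using ex_character_ge[OF N f _ s(2)] by blast
    then have "\<bar>\<phi> f\<bar> \<le> Sup ?S" by (intro cSup_upper bdd) auto
    then show False using \<phi> s by simp
  qed
  ultimately show ?thesis using eq by simp
qed

lemma mem_of_coset_norm_zero:
  assumes "coset_norm (Q N f) = 0"
  shows "f \<in> N"
proof -
  note N' = closed_lattice_idealD[OF N]
  have "\<exists>n\<in>N. dist n f < e" if "0 < e" for e
  proof -
    have "coset_norm (Q N f) < e" using that assms by simp
    then obtain n where n: "n \<in> N" "norm (f + n) < e"
      by (rule coset_norm_lessE[OF subspace_0[OF N'(3)]])
    then have "dist (- n) f < e" by (simp add: dist_norm norm_minus_commute)
    then show ?thesis using subspace_neg[OF N'(3) n(1)] by blast
  qed
  then show ?thesis using N'(2) closed_approachable by blast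
qed

text \<open>From characters to cosets: every character kills the positive part \<open>h\<close> of
  \<open>f - g\<close>, so by the isometry \<open>h\<close> lies in \<open>N\<close>, while
  \<open>f \<le> g + h\<close> pointwise. Conversely, characters are monotone and vanish on
  \<open>N\<close>.\<close>

lemma C_le_character_iff:
  assumes f: "f \<in> E_C" and g: "g \<in> E_C"
  shows "C_le (top_of_set (lattice_characters N)) (character_transform N (Q N f)) (character_transform N (Q N g))
    \<longleftrightarrow> coset_le (Q N f) (Q N g)"
proof
  note N' = closed_lattice_idealD[OF N]
  note zero = subspace_0[OF N'(3)]
  {
    assume "C_le (top_of_set (lattice_characters N)) (character_transform N (Q N f)) (character_transform N (Q N g))"
    then have le: "\<phi> f \<le> \<phi> g" if "\<phi> \<in> lattice_characters N" for \<phi>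
      using that by (auto simp: C_le_def character_transform_Q[OF zero])
    define h where "h = cb_max (f - g) 0"
    have h: "h \<in> E_C"
      unfolding h_def using f g subspace_0[OF subspace_E_C] by (intro cb_max_in_E_C subspace_diff[OF subspace_E_C])
    have "\<phi> h = 0" if \<phi>: "\<phi> \<in> lattice_characters N" for \<phi>
      using le[OF \<phi>] by (simp add: h_def character_max[OF \<phi>] character_diff[OF \<phi>] character_zero_on[OF \<phi> zero])
    then have "character_transform N (Q N h) = (\<lambda>\<phi>. 0)"
      by (auto simp: character_transform_Q[OF zero])
    then have "C_norm (top_of_set (lattice_characters N)) (character_transform N (Q N h)) = 0"
      by (simp add: C_norm_def image_constant_conv)
    then have "h \<in> N"
      using coset_norm_character[OF h] by (intro mem_of_coset_norm_zero) simp
    show "coset_le (Q N f) (Q N g)"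
      unfolding coset_le_def
    proof (intro bexI allI)
      show "f + 0 \<in> Q N f" unfolding Q_def using zero by (rule imageI)
      show "g + h \<in> Q N g" unfolding Q_def using \<open>h \<in> N\<close> by (rule imageI)
      show "(f + 0) \<omega> \<le> (g + h) \<omega>" for \<omega> by (simp add: h_def max_def)
    qed
  }
  {
    assume "coset_le (Q N f) (Q N g)"
    then obtain n m where nm: "n \<in> N" "m \<in> N" "\<And>\<omega>. (f + n) \<omega> \<le> (g + m) \<omega>"
      by (auto simp: coset_le_def Q_def)
    have "\<phi> f \<le> \<phi> g" if "\<phi> \<in> lattice_characters N" for \<phi>
      using character_mono[OF that nm(3)] nm by (simp add: character_add[OF that] character_zero_on[OF that])
    then show "C_le (top_of_set (lattice_characters N)) (character_transform N (Q N f)) (character_transform N (Q N g))"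
      by (auto simp: C_le_def character_transform_Q[OF zero])
  }
qed

lemma linear_order_isometry_character_transform:
  "linear_order_isometry_onto_sublattice N (top_of_set (lattice_characters N)) (character_transform N)"
  unfolding linear_order_isometry_onto_sublattice_def
proof (intro conjI ballI allI)
  note T = character_transform_Q[OF subspace_0[OF closed_lattice_idealD(3)[OF N]]]
  fix f g :: "'a cb_dual" assume f: "f \<in> E_C"
  show "C_norm (top_of_set (lattice_characters N)) (character_transform N (Q N f)) = coset_norm (Q N f)"
    by (rule coset_norm_character[OF f])
  have "continuous_on (lattice_characters N) (\<lambda>\<phi>. \<phi> f)"
    by (rule continuous_on_subset[OF continuous_on_product_coordinates]) simp
  then have "continuous_on (lattice_characters N) (character_transform N (Q N f))"
    by (rule continuous_on_eq) (simp add: T)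
  then show "character_transform N (Q N f) \<in> C_space (top_of_set (lattice_characters N))"
    by (simp add: C_space_def T)
  show "character_transform N (Q N (c *\<^sub>R f)) = (\<lambda>k. c * character_transform N (Q N f) k)" for c
    by (auto simp: T character_scaleR)
  assume g: "g \<in> E_C"
  show "C_le (top_of_set (lattice_characters N)) (character_transform N (Q N f)) (character_transform N (Q N g))
      \<longleftrightarrow> coset_le (Q N f) (Q N g)"
    by (rule C_le_character_iff[OF f g])
  show "character_transform N (Q N (f + g)) = (\<lambda>k. character_transform N (Q N f) k + character_transform N (Q N g) k)"
    by (auto simp: T character_add)
  show "\<exists>h\<in>E_C. character_transform N (Q N h) = (\<lambda>k. max (character_transform N (Q N f) k) (character_transform N (Q N g) k))"
    by (rule bexI[OF _ cb_max_in_E_C[OF f g]]) (auto simp: T character_max)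
  show "\<exists>h\<in>E_C. character_transform N (Q N h) = (\<lambda>k. min (character_transform N (Q N f) k) (character_transform N (Q N g) k))"
    by (rule bexI[OF _ cb_min_in_E_C[OF f g]]) (auto simp: T character_min)
qed

end

text \<open>The first conjunct treats every given \<open>K\<close> and \<open>T\<close>, for the
  quotient by \<open>E_K\<close> as well as by \<open>E_K_ideal\<close>. The second exhibits such a
  pair for \<open>E_K_ideal\<close>, so the first is not vacuous there when its type of points
  matches.\<close>

theorem theorem3p11:
  assumes infinite_dimensional: "\<nexists>S :: 'a::banach set. finite S \<and> span S = UNIV"
  shows
    "(\<forall>N \<in> {E_K, E_K_ideal :: 'a cb_dual set}. \<forall>(K :: 'k topology) T.
        compact_space K \<and> Hausdorff_space K \<and> linear_order_isometry_onto_sublattice N K T \<longrightarrow>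
        (\<forall>\<mu>. convex_mnc \<mu> \<longrightarrow> (\<exists>F. represents_mnc K (TQJ N T) \<mu> F))) \<and>
     (\<exists>(K :: ('a cb_dual \<Rightarrow> real) topology) T.
        compact_space K \<and> Hausdorff_space K \<and>
        linear_order_isometry_onto_sublattice (E_K_ideal :: 'a cb_dual set) K T \<and>
        (\<forall>\<mu>. convex_mnc \<mu> \<longrightarrow> (\<exists>F. represents_mnc K (TQJ E_K_ideal T) \<mu> F)))"
proof (intro conjI)
  have N: "E_K \<subseteq> N \<and> N \<subseteq> compactly_dominated" if "N \<in> {E_K, E_K_ideal}" for N :: "'a cb_dual set"
    using that E_K_compactly_dominated E_K_subset_E_K_ideal E_K_ideal_compactly_dominated by auto
  show "\<forall>N \<in> {E_K, E_K_ideal :: 'a cb_dual set}. \<forall>(K :: 'k topology) T.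
        compact_space K \<and> Hausdorff_space K \<and> linear_order_isometry_onto_sublattice N K T \<longrightarrow>
        (\<forall>\<mu>. convex_mnc \<mu> \<longrightarrow> (\<exists>F. represents_mnc K (TQJ N T) \<mu> F))"
  proof (intro ballI allI impI)
    fix N :: "'a cb_dual set" and K :: "'k topology" and T and \<mu> :: "'a set \<Rightarrow> real"
    assume "N \<in> {E_K, E_K_ideal}"
      and T: "compact_space K \<and> Hausdorff_space K \<and> linear_order_isometry_onto_sublattice N K T"
      and \<mu>: "convex_mnc \<mu>"
    then show "\<exists>F. represents_mnc K (TQJ N T) \<mu> F"
      using N by (intro ex_represents_mnc) auto
  qed
  let ?K = "top_of_set (lattice_characters (E_K_ideal :: 'a cb_dual set))"
  have iso: "linear_order_isometry_onto_sublattice (E_K_ideal :: 'a cb_dual set) ?K (character_transform E_K_ideal)"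
    by (rule linear_order_isometry_character_transform[OF closed_lattice_ideal_E_K_ideal])
  have "compact_space ?K"
    by (simp add: compact_space_subtopology compact_lattice_characters)
  moreover have "Hausdorff_space ?K"
  proof (rule Hausdorff_space_subtopology)
    show "Hausdorff_space (euclidean :: ('a cb_dual \<Rightarrow> real) topology)"
      unfolding euclidean_product_topology[symmetric] by (simp add: Hausdorff_space_product_topology)
  qed
  moreover have "\<exists>F. represents_mnc ?K (TQJ E_K_ideal (character_transform E_K_ideal)) \<mu> F"
    if "convex_mnc \<mu>" for \<mu> :: "'a set \<Rightarrow> real"
    using ex_represents_mnc[OF _ _ iso that] N[of E_K_ideal] by simp
  ultimately show "\<exists>(K :: ('a cb_dual \<Rightarrow> real) topology) T.
        compact_space K \<and> Hausdorff_space K \<and>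
        linear_order_isometry_onto_sublattice (E_K_ideal :: 'a cb_dual set) K T \<and>
        (\<forall>\<mu>. convex_mnc \<mu> \<longrightarrow> (\<exists>F. represents_mnc K (TQJ E_K_ideal T) \<mu> F))"
    using iso by blast
qed

end
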